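(* For any graph $G$ and integer $k\geq\mathrm{tw}(G)$, $G$ has a tree-decomposition with width at most $56k+58$ and order at most $\max\{\frac{|V(G)|}{14k+14},1\}$, such that each vertex $v\in V(G)$ has spread at most $\deg_G(v)+1$.
   Context: Graphs are simple, undirected and finite. For a non-empty tree $T$, a $T$-decomposition of a graph $G$ is a collection $(B_x:x\in V(T))$ of subsets $B_x\subseteq V(G)$ (bags) such that for each edge $vw\in E(G)$ some bag contains both $v$ and $w$, and for each $v\in V(G)$ the set $\{x\in V(T):v\in B_x\}$ induces a non-empty connected subtree of $T$. A tree-decomposition is a $T$-decomposition for some tree $T$. Its width is $\max_x|B_x|-1$, its order is $|V(T)|$, and the spread of a vertex $v$ is the number of nodes $x$ with $v\in B_x$. $\mathrm{tw}(G)$ is the minimum width of a tree-decomposition of $G$. *)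

theory Defs
  imports Complex_Main "Graph_Theory.Graph_Theory"
begin

text \<open>
  Finite simple undirected graphs are the symmetric loop-free finite digraphs of
  locale \<^locale>\<open>pair_graph\<close>: each edge \<open>vw\<close> is the pair of arcs \<open>(v,w)\<close>, \<open>(w,v)\<close>.
  The null graph is allowed.

  \<^const>\<open>tree\<close> cannot be used for such graphs: it forbids directed cycles, and
  traversing an edge back and forth is a directed cycle of length 2. A cycle of the
  undirected graph is a \<^const>\<open>pre_digraph.cycle\<close> of length at least 3.
  Note that \<^const>\<open>connected\<close> excludes the null graph.
\<close>

definition undirected_tree :: "'b pair_pre_digraph \<Rightarrow> bool" where
  "undirected_tree T \<longleftrightarrow> pair_graph T \<and> connected (with_proj T) \<and>
     \<not> (\<exists>p. pre_digraph.cycle (with_proj T) p \<and> length p \<ge> 3)"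

definition tree_decomposition ::
    "'a pair_pre_digraph \<Rightarrow> 'b pair_pre_digraph \<Rightarrow> ('b \<Rightarrow> 'a set) \<Rightarrow> bool" where
  "tree_decomposition G T B \<longleftrightarrow>
     undirected_tree T \<and>
     (\<forall>x\<in>pverts T. B x \<subseteq> pverts G) \<and>
     (\<forall>v w. (v, w) \<in> parcs G \<longrightarrow> (\<exists>x\<in>pverts T. v \<in> B x \<and> w \<in> B x)) \<and>
     (\<forall>v\<in>pverts G. connected (with_proj T \<restriction> {x \<in> pverts T. v \<in> B x}))"

text \<open>The width is an integer, as the null graph has decompositions of width \<open>-1\<close>.\<close>

definition td_width :: "'b pair_pre_digraph \<Rightarrow> ('b \<Rightarrow> 'a set) \<Rightarrow> int" where
  "td_width T B = int (Max ((\<lambda>x. card (B x)) ` pverts T)) - 1"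

definition td_order :: "'b pair_pre_digraph \<Rightarrow> nat" where
  "td_order T = card (pverts T)"

definition td_spread :: "'b pair_pre_digraph \<Rightarrow> ('b \<Rightarrow> 'a set) \<Rightarrow> 'a \<Rightarrow> nat" where
  "td_spread T B v = card {x \<in> pverts T. v \<in> B x}"

text \<open>
  Nodes are taken from \<^typ>\<open>nat\<close> without loss of generality, as every finite tree has
  an isomorphic copy there. That the minimum exists is shown below.
\<close>

definition treewidth :: "'a pair_pre_digraph \<Rightarrow> int" where
  "treewidth G =
     (LEAST w. \<exists>(T :: nat pair_pre_digraph) B. tree_decomposition G T B \<and> td_width T B = w)"

text \<open>
  In a \<^locale>\<open>pair_graph\<close> the out-degree of a vertex is its number of neighbours.
\<close>

abbreviation degree :: "'a pair_pre_digraph \<Rightarrow> 'a \<Rightarrow> nat" where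
  "degree G v \<equiv> out_degree (with_proj G) v"

lemma degree_eq_card_neighbours: "degree G v = card {w. (v, w) \<in> parcs G}"
proof -
  have "out_arcs (with_proj G) v = Pair v ` {w. (v, w) \<in> parcs G}"
    by (auto simp: out_arcs_def)
  then show ?thesis
    unfolding out_degree_def by (simp add: card_image inj_on_def)
qed

lemma single_node_connected:
  assumes "pverts T = {a}"
  shows "connected (with_proj T)"
  using assms
  by (auto simp: connected_def strongly_connected_def mk_symmetric_def reachable_def)

lemma single_node_tree: "undirected_tree \<lparr>pverts = {a}, parcs = {}\<rparr>" (is "undirected_tree ?T")
proof -
  have "pair_graph ?T"
    by unfold_locales (auto simp: symmetric_def sym_def)
  moreover have "\<not> pre_digraph.cycle (with_proj ?T) p" for p
    by (cases p) (auto simp: pre_digraph.cycle_def pre_digraph.awalk_def)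
  ultimately show ?thesis
    unfolding undirected_tree_def using single_node_connected[of ?T a] by auto
qed

lemma single_bag_decomposition:
  assumes "pair_graph G"
  shows "tree_decomposition G \<lparr>pverts = {a}, parcs = {}\<rparr> (\<lambda>_. pverts G)"
proof -
  let ?T = "\<lparr>pverts = {a}, parcs = {}\<rparr>"
  interpret pair_graph G by fact
  have "connected (with_proj ?T \<restriction> {x \<in> pverts ?T. v \<in> pverts G})" if "v \<in> pverts G" for v
    using that
    by (auto simp: connected_def strongly_connected_def mk_symmetric_def reachable_def)
  then show ?thesis
    unfolding tree_decomposition_def using single_node_tree[of a] in_arcsD1 in_arcsD2 by auto
qed

lemma int_Least_attained:
  fixes P :: "int \<Rightarrow> bool"
  assumes "P w" and lower: "\<And>w. P w \<Longrightarrow> b \<le> w"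
  shows "P (LEAST w. P w)" and "\<And>w. P w \<Longrightarrow> (LEAST w. P w) \<le> w"
proof -
  define n where "n = (LEAST n. P (b + int n))"
  have "P (b + int (nat (w - b)))"
    using assms lower[of w] by simp
  then have n: "P (b + int n)"
    unfolding n_def by (rule LeastI)
  have min: "b + int n \<le> w'" if "P w'" for w'
  proof -
    have "P (b + int (nat (w' - b)))"
      using that lower[OF that] by simp
    then have "n \<le> nat (w' - b)"
      unfolding n_def by (rule Least_le)
    then show ?thesis
      using lower[OF that] by linarith
  qed
  have "(LEAST w. P w) = b + int n"
    using n min by (rule Least_equality)
  with n min show "P (LEAST w. P w)" and "\<And>w. P w \<Longrightarrow> (LEAST w. P w) \<le> w"
    by simp_all
qed

lemma treewidth_attained:
  assumes "pair_graph G"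
  shows "\<exists>(T :: nat pair_pre_digraph) B. tree_decomposition G T B \<and> td_width T B = treewidth G"
proof -
  define P where
    "P w \<longleftrightarrow> (\<exists>(T :: nat pair_pre_digraph) B. tree_decomposition G T B \<and> td_width T B = w)" for w
  have "P (LEAST w. P w)"
  proof (rule int_Least_attained(1)[where P = P and b = "- 1"])
    show "P (td_width \<lparr>pverts = {0 :: nat}, parcs = {}\<rparr> (\<lambda>_. pverts G))"
      unfolding P_def by (rule exI, rule exI, rule conjI[OF single_bag_decomposition[OF assms] refl])
    show "- 1 \<le> w" if w: "P w" for w
    proof -
      obtain T :: "nat pair_pre_digraph" and B :: "nat \<Rightarrow> 'a set" where "w = td_width T B"
        using w unfolding P_def by blast
      then show ?thesis
        by (simp add: td_width_def)
    qed
  qed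
  then show ?thesis
    unfolding treewidth_def P_def .
qed

lemma treewidth_le:
  fixes T :: "nat pair_pre_digraph"
  assumes "tree_decomposition G T B"
  shows "treewidth G \<le> td_width T B"
proof -
  define P where
    "P w \<longleftrightarrow> (\<exists>(T :: nat pair_pre_digraph) B. tree_decomposition G T B \<and> td_width T B = w)" for w
  have "(LEAST w. P w) \<le> td_width T B"
  proof (rule int_Least_attained(2)[where P = P and b = "- 1"])
    show "P (td_width T B)"
      unfolding P_def using assms by blast
    then show "P (td_width T B)" .
    show "- 1 \<le> w" if w: "P w" for w
    proof -
      obtain T :: "nat pair_pre_digraph" and B :: "nat \<Rightarrow> 'a set" where "w = td_width T B"
        using w unfolding P_def by blast
      then show ?thesis
        by (simp add: td_width_def)
    qed
  qed
  then show ?thesis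
    unfolding treewidth_def P_def .
qed

end

theory Submission
  imports Defs
begin

text \<open>
  Write \<open>m = k + 1\<close>. The low spread comes from a recursion on a pair \<open>(G, S)\<close>, where the root
  bag has to contain \<open>S\<close>. If \<open>|S| \<le> 12m\<close>, the root bag is \<open>S\<close> itself and its child recurses with
  \<open>S'\<close>: the vertices of \<open>S\<close> that have a neighbour outside \<open>S\<close>, together with one such neighbour
  for each. The chosen edge at such a vertex \<open>v\<close> is covered by the child and then deleted, which
  pays for the occurrence of \<open>v\<close> in the root bag; moreover \<open>|S'| \<le> 24m\<close>. If \<open>|S| > 12m\<close>, a
  balanced separation \<open>(X, Y)\<close> of \<open>S\<close> with \<open>|X \<inter> Y| \<le> m\<close> splits the edges of \<open>G\<close> into two
  instances that both contain \<open>X \<inter> Y\<close> in the root bag, and their roots are identified. All bags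
  have size at most \<open>27m\<close>.

  The order is then reduced by contracting edges of the tree and identifying siblings, neither of
  which increases a spread. Working upwards, parts are closed as soon as they contain \<open>14m\<close>
  vertices not in the parent bag, so the order is at most \<open>|V| / 14m\<close>, and the bags have size at
  most \<open>27m + 2 \<cdot> 14m\<close>.
\<close>

section \<open>Rooted trees of bags\<close>

text \<open>\<open>Attach t u\<close> makes the root of \<open>u\<close> a child of the root of \<open>t\<close>.\<close>

datatype 'a bagtree = Bag "'a set" | Attach "'a bagtree" "'a bagtree"

primrec root_bag :: "'a bagtree \<Rightarrow> 'a set" where
  "root_bag (Bag X) = X"
| "root_bag (Attach t u) = root_bag t"

primrec bags :: "'a bagtree \<Rightarrow> 'a set set" where
  "bags (Bag X) = {X}"
| "bags (Attach t u) = bags t \<union> bags u"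

primrec order :: "'a bagtree \<Rightarrow> nat" where
  "order (Bag X) = 1"
| "order (Attach t u) = order t + order u"

primrec spread :: "'a bagtree \<Rightarrow> 'a \<Rightarrow> nat" where
  "spread (Bag X) v = (if v \<in> X then 1 else 0)"
| "spread (Attach t u) v = spread t v + spread u v"

text \<open>Local form of the connectedness condition: at each tree edge, a vertex occurring on both
  sides must be held by both ends, so that its nodes on the two sides are joined. By induction the
  nodes holding a vertex form a subtree.\<close>

primrec coherent :: "'a bagtree \<Rightarrow> bool" where
  "coherent (Bag X) \<longleftrightarrow> True"
| "coherent (Attach t u) \<longleftrightarrow>
     coherent t \<and> coherent u \<and> \<Union>(bags t) \<inter> \<Union>(bags u) \<subseteq> root_bag t \<inter> root_bag u"

primrec widen :: "'a set \<Rightarrow> 'a bagtree \<Rightarrow> 'a bagtree" where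
  "widen X (Bag Y) = Bag (X \<union> Y)"
| "widen X (Attach t u) = Attach (widen X t) u"

text \<open>Identification of the two roots, whose bags are united. Applied to two children it
  merges siblings; applied to a tree and its child it contracts the edge between them.\<close>

primrec glue :: "'a bagtree \<Rightarrow> 'a bagtree \<Rightarrow> 'a bagtree" where
  "glue (Bag X) s = widen X s"
| "glue (Attach t u) s = Attach (glue t s) u"

lemma root_in_bags: "root_bag t \<in> bags t"
  by (induction t) auto

lemma root_subset_bags: "root_bag t \<subseteq> \<Union>(bags t)"
  using root_in_bags by blast

lemma spread_eq_0: "v \<notin> \<Union>(bags t) \<Longrightarrow> spread t v = 0"
  by (induction t) auto

lemma root_widen [simp]: "root_bag (widen X t) = X \<union> root_bag t"
  by (induction t) auto

lemma Union_bags_widen [simp]: "\<Union>(bags (widen X t)) = X \<union> \<Union>(bags t)"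
  by (induction t) auto

lemma bags_widen: "Y \<in> bags (widen X t) \<Longrightarrow> Y \<in> bags t \<or> Y = X \<union> root_bag t"
  by (induction t) auto

lemma bags_widen_covers: "Y \<in> bags t \<Longrightarrow> \<exists>Z\<in>bags (widen X t). Y \<subseteq> Z"
  by (induction t) auto

lemma order_widen [simp]: "order (widen X t) = order t"
  by (induction t) auto

lemma spread_widen: "spread (widen X t) v = spread t v + (if v \<in> X - root_bag t then 1 else 0)"
  by (induction t) auto

lemma coherent_widen: "coherent t \<Longrightarrow> X \<inter> \<Union>(bags t) \<subseteq> root_bag t \<Longrightarrow> coherent (widen X t)"
proof (induction t)
  case (Attach t u)
  moreover have "root_bag t \<subseteq> \<Union>(bags t)" by (rule root_subset_bags)
  ultimately show ?case by auto blast+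
qed simp

lemma root_glue [simp]: "root_bag (glue t s) = root_bag t \<union> root_bag s"
  by (induction t) auto

lemma Union_bags_glue [simp]: "\<Union>(bags (glue t s)) = \<Union>(bags t) \<union> \<Union>(bags s)"
  by (induction t) auto

lemma bags_glue: "Y \<in> bags (glue t s) \<Longrightarrow> Y \<in> bags t \<or> Y \<in> bags s \<or> Y = root_bag t \<union> root_bag s"
  by (induction t) (auto dest: bags_widen)

lemma bags_glue_covers:
  "Y \<in> bags t \<union> bags s \<Longrightarrow> \<exists>Z\<in>bags (glue t s). Y \<subseteq> Z"
proof (induction t)
  case (Bag X)
  show ?case
  proof (cases "Y = X")
    case True
    then show ?thesis
      using root_in_bags[of "widen X s"] by auto
  next
    case False
    then show ?thesis using Bag bags_widen_covers by auto
  qed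
qed auto

lemma order_glue: "order (glue t s) + 1 = order t + order s"
  by (induction t) auto

lemma order_pos: "order t > 0"
  by (induction t) auto

text \<open>Only a vertex in both root bags is affected: two of its occurrences become one. This
  saving is what makes the bound degree plus one survive the union of two instances. The additive
  form avoids truncated subtraction, here as in \<open>order_glue\<close>.\<close>

lemma spread_glue:
  "spread (glue t s) v + (if v \<in> root_bag t \<inter> root_bag s then 1 else 0) = spread t v + spread s v"
  by (induction t) (auto simp: spread_widen)

lemma coherent_glue:
  "coherent t \<Longrightarrow> coherent s \<Longrightarrow> \<Union>(bags t) \<inter> \<Union>(bags s) \<subseteq> root_bag t \<inter> root_bag s \<Longrightarrow>
    coherent (glue t s)"
proof (induction t)
  case (Bag X)
  then show ?case by (auto intro!: coherent_widen)
next
  case (Attach t u)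
  have "root_bag t \<subseteq> \<Union>(bags t)" by (rule root_subset_bags)
  with Attach show ?case by auto blast+
qed

section \<open>Reducing the order by contracting and closing parts\<close>

text \<open>
  \<open>p\<close> collects children of the root of \<open>t\<close> whose parts are still too small to be closed; gluing
  it to \<open>t'\<close> (contraction into the root) or attaching it to \<open>t'\<close> (closing the part) are both
  possible later on. Initially \<open>p\<close> is the empty bag, whose contribution to the order is
  cancelled by gluing.
\<close>

definition compression ::
    "nat \<Rightarrow> nat \<Rightarrow> 'a bagtree \<Rightarrow> 'a bagtree \<Rightarrow> 'a bagtree \<Rightarrow> bool" where
  "compression c q t t' p \<longleftrightarrow>
     coherent t' \<and> coherent p \<and> root_bag t' = root_bag t \<and>
     \<Union>(bags t') \<union> \<Union>(bags p) = \<Union>(bags t) \<and>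
     \<Union>(bags t') \<inter> \<Union>(bags p) \<subseteq> root_bag t \<inter> root_bag p \<and>
     card (root_bag p - root_bag t) < q \<and>
     (\<forall>X\<in>bags t' \<union> bags p. card X \<le> c + 2 * q) \<and>
     (\<forall>v. spread t' v + spread p v \<le> spread t v) \<and>
     q * (order t' + order p) + card (root_bag p - root_bag t) \<le> card (\<Union>(bags t) - root_bag t) + 2 * q \<and>
     (\<forall>X\<in>bags t. \<exists>Y\<in>bags t' \<union> bags p. X \<subseteq> Y)"

lemma compressionD:
  assumes "compression c q t t' p"
  shows "coherent t'" "coherent p" "root_bag t' = root_bag t"
    "\<Union>(bags t') \<union> \<Union>(bags p) = \<Union>(bags t)"
    "\<Union>(bags t') \<inter> \<Union>(bags p) \<subseteq> root_bag t \<inter> root_bag p"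
    "card (root_bag p - root_bag t) < q"
    "\<And>X. X \<in> bags t' \<union> bags p \<Longrightarrow> card X \<le> c + 2 * q"
    "\<And>v. spread t' v + spread p v \<le> spread t v"
    "q * (order t' + order p) + card (root_bag p - root_bag t)
      \<le> card (\<Union>(bags t) - root_bag t) + 2 * q"
    "\<And>X. X \<in> bags t \<Longrightarrow> \<exists>Y\<in>bags t' \<union> bags p. X \<subseteq> Y"
proof -
  note C = assms[unfolded compression_def]
  show "card X \<le> c + 2 * q" if "X \<in> bags t' \<union> bags p" for X
    using C that by (elim conjE) (rule bspec)
  show "spread t' v + spread p v \<le> spread t v" for v
    using C by (elim conjE) (rule spec)
  show "\<exists>Y\<in>bags t' \<union> bags p. X \<subseteq> Y" if "X \<in> bags t" for X
    using C that by (elim conjE) (rule bspec)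
qed (insert assms[unfolded compression_def], elim conjE, assumption)+

text \<open>Contracting the pending part into the root removes one node, and the vertices of
  \<open>root_bag p - root_bag t\<close> move into the new root bag. Hence every node except the
  root is charged to \<open>q\<close> vertices outside the root bag; the summand \<open>q\<close>
  stands for the root.\<close>

lemma compression_glue:
  assumes "compression c q t t' p" "finite (\<Union>(bags t))" "\<forall>X\<in>bags t. card X \<le> c"
  defines "s \<equiv> glue t' p"
  shows "coherent s" "\<Union>(bags s) = \<Union>(bags t)" "root_bag t \<subseteq> root_bag s"
    "card (root_bag s) < c + q" "\<And>X. X \<in> bags s \<Longrightarrow> card X \<le> c + 2 * q"
    "\<And>v. spread s v \<le> spread t v"
    "q * order s \<le> card (\<Union>(bags t) - root_bag s) + q"
    "\<And>X. X \<in> bags t \<Longrightarrow> \<exists>Y\<in>bags s. X \<subseteq> Y"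
proof -
  note D = compressionD[OF assms(1)]
  have sr: "root_bag s = root_bag t \<union> root_bag p" by (simp add: s_def D(3))
  have sub: "root_bag t \<subseteq> \<Union>(bags t)" "root_bag p \<subseteq> \<Union>(bags t)"
    using root_subset_bags[of t] root_subset_bags[of p] D(4) by auto
  show "coherent s"
    unfolding s_def by (rule coherent_glue) (use D in auto)
  show "\<Union>(bags s) = \<Union>(bags t)" unfolding s_def Union_bags_glue by (rule D(4))
  show "root_bag t \<subseteq> root_bag s" using sr by auto
  have "card (root_bag s) \<le> card (root_bag t) + card (root_bag p - root_bag t)"
    unfolding sr by (metis Un_Diff_cancel card_Un_le)
  moreover have "card (root_bag t) \<le> c" using assms(3) root_in_bags[of t] by auto
  ultimately show cs: "card (root_bag s) < c + q" using D(6) by linarith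
  show "card X \<le> c + 2 * q" if X: "X \<in> bags s" for X
  proof (cases "X = root_bag s")
    case True
    then show ?thesis using cs by simp
  next
    case False
    then show ?thesis using X bags_glue[of X t' p] D(7) unfolding s_def by auto
  qed
  show "spread s v \<le> spread t v" for v
    using spread_glue[of t' p v] D(8)[of v] unfolding s_def by linarith
  have "\<Union>(bags t) - root_bag t = (\<Union>(bags t) - root_bag s) \<union> (root_bag p - root_bag t)"
    using sr sub by auto
  moreover have "card ((\<Union>(bags t) - root_bag s) \<union> (root_bag p - root_bag t))
      = card (\<Union>(bags t) - root_bag s) + card (root_bag p - root_bag t)"
    by (rule card_Un_disjoint) (use assms(2) sub sr in \<open>auto intro: finite_subset\<close>)
  moreover have "q * (order t' + order p) = q * order s + q"
    unfolding s_def using order_glue[of t' p] by (metis add_mult_distrib2 mult.right_neutral)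
  ultimately show "q * order s \<le> card (\<Union>(bags t) - root_bag s) + q"
    using D(9) by simp
  show "\<exists>Y\<in>bags s. X \<subseteq> Y" if X: "X \<in> bags t" for X
  proof -
    obtain Y where "Y \<in> bags t' \<union> bags p" "X \<subseteq> Y" using D(10)[OF X] by blast
    then show ?thesis using bags_glue_covers[of Y t' p] unfolding s_def by blast
  qed
qed

text \<open>At \<open>Attach t u\<close> the child is contracted to \<open>s\<close>. If its root
  bag has \<open>q\<close> vertices outside the parent bag it is closed; otherwise it joins the
  pending part, which is closed in turn once it has \<open>q\<close> such vertices. A pending part
  below \<open>q\<close> and a child below \<open>q\<close> added to a parent bag of size at most
  \<open>c\<close> give bags of size at most \<open>c + 2 * q\<close>.\<close>

lemma compression_exists:
  assumes "coherent t" "finite (\<Union>(bags t))" "\<forall>X\<in>bags t. card X \<le> c" "0 < q"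
  shows "\<exists>t' p. compression c q t t' p"
  using assms(1-3)
proof (induction t)
  case (Bag X)
  have "compression c q (Bag X) (Bag X) (Bag {})"
    using Bag assms(4) by (auto simp: compression_def)
  then show ?case by blast
next
  case (Attach t u)
  have fin: "finite (\<Union>(bags t))" "finite (\<Union>(bags u))" using Attach.prems(2) by auto
  obtain t' p where tp: "compression c q t t' p"
    using Attach by auto
  obtain u' r where ur: "compression c q u u' r"
    using Attach by auto
  define s where "s = glue u' r"
  let ?V = "\<Union>(bags t)" and ?W = "\<Union>(bags u)"
  note T = compressionD[OF tp]
  have "\<forall>X\<in>bags u. card X \<le> c" using Attach.prems(3) by auto
  note S = compression_glue[OF ur fin(2) this, folded s_def]
  have VW: "?V \<inter> ?W \<subseteq> root_bag t \<inter> root_bag u" using Attach.prems(1) by auto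
  have VW': "x \<in> ?V \<Longrightarrow> x \<in> ?W \<Longrightarrow> x \<in> root_bag t \<and> x \<in> root_bag s" for x
    using VW S(3) by blast
  have sub: "root_bag t \<subseteq> ?V" "root_bag p \<subseteq> \<Union>(bags p)" "root_bag s \<subseteq> ?W"
    using root_subset_bags[of t] root_subset_bags[of p] root_subset_bags[of s] S(2) by auto
  have pV: "\<Union>(bags p) \<subseteq> ?V" "\<Union>(bags t') \<subseteq> ?V"
    using T(4) by auto
  have tp_int: "x \<in> \<Union>(bags t') \<Longrightarrow> x \<in> \<Union>(bags p) \<Longrightarrow> x \<in> root_bag t \<and> x \<in> root_bag p" for x
    using T(5) by blast
  have rt': "root_bag t \<subseteq> \<Union>(bags t')"
    using root_subset_bags[of t'] T(3) by auto
  have t's_int: "\<Union>(bags t') \<inter> ?W \<subseteq> root_bag t \<inter> root_bag s"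
    using pV VW' by blast
  have ps_int: "\<Union>(bags p) \<inter> ?W \<subseteq> root_bag t \<inter> root_bag p \<inter> root_bag s"
  proof
    fix x assume x: "x \<in> \<Union>(bags p) \<inter> ?W"
    then have "x \<in> root_bag t" "x \<in> root_bag s" using pV VW'[of x] by blast+
    then show "x \<in> root_bag t \<inter> root_bag p \<inter> root_bag s"
      using tp_int[of x] rt' x by blast
  qed
  \<comment> \<open>The last summand counts the vertices that \<open>s\<close> introduces in its
    root bag. They either pay for the node when \<open>s\<close> is closed or are carried over to
    the pending part.\<close>
  have VWcard: "card (?V \<union> ?W - root_bag t)
      = card (?V - root_bag t) + card (?W - root_bag s) + card (root_bag s - root_bag t)"
  proof -
    have eq: "?V \<union> ?W - root_bag t
        = (?V - root_bag t) \<union> ((?W - root_bag s) \<union> (root_bag s - root_bag t))"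
      using sub VW' by blast
    have f: "finite (?W - root_bag s)" "finite (root_bag s - root_bag t)" "finite (?V - root_bag t)"
      using fin sub by (auto intro: finite_subset)
    have "card ((?W - root_bag s) \<union> (root_bag s - root_bag t))
        = card (?W - root_bag s) + card (root_bag s - root_bag t)"
      by (rule card_Un_disjoint) (use f in auto)
    moreover have "(?V - root_bag t) \<inter> ((?W - root_bag s) \<union> (root_bag s - root_bag t)) = {}"
      using VW' sub by blast
    then have "card ((?V - root_bag t) \<union> ((?W - root_bag s) \<union> (root_bag s - root_bag t)))
      = card (?V - root_bag t) + card ((?W - root_bag s) \<union> (root_bag s - root_bag t))"
      using f by (intro card_Un_disjoint) auto
    ultimately show ?thesis using eq by simp
  qed
  show ?case
  proof (cases "q \<le> card (root_bag s - root_bag t)")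
    case True
    have "compression c q (Attach t u) (Attach t' s) p"
      unfolding compression_def
    proof (intro conjI allI ballI)
      show "coherent (Attach t' s)"
        using T(1,3) S(1,2) t's_int by simp
      show "\<Union>(bags (Attach t' s)) \<union> \<Union>(bags p) = \<Union>(bags (Attach t u))"
        using T(4) S(2) by auto
      show "\<Union>(bags (Attach t' s)) \<inter> \<Union>(bags p) \<subseteq> root_bag (Attach t u) \<inter> root_bag p"
        using tp_int S(2) ps_int by simp blast
      show "spread (Attach t' s) v + spread p v \<le> spread (Attach t u) v" for v
        using T(8)[of v] S(6)[of v] by simp
      show "q * (order (Attach t' s) + order p) + card (root_bag p - root_bag (Attach t u))
        \<le> card (\<Union>(bags (Attach t u)) - root_bag (Attach t u)) + 2 * q"
        using T(9) S(7) VWcard True by (simp add: algebra_simps)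
      show "\<exists>Y\<in>bags (Attach t' s) \<union> bags p. X \<subseteq> Y" if "X \<in> bags (Attach t u)" for X
        using that T(10)[of X] S(8)[of X] by auto
      show "card X \<le> c + 2 * q" if "X \<in> bags (Attach t' s) \<union> bags p" for X
        using that T(7)[of X] S(5)[of X] by auto
    qed (use T in simp_all)
    then show ?thesis by blast
  next
    case False
    \<comment> \<open>The child is too small to be closed and is merged with its pending
      siblings.\<close>
    define g where "g = glue p s"
    have g_coh: "coherent g"
      unfolding g_def by (rule coherent_glue) (use T(2) S(1,2) ps_int in auto)
    have g_root: "root_bag g = root_bag p \<union> root_bag s" and g_V: "\<Union>(bags g) = \<Union>(bags p) \<union> ?W"
      by (simp_all add: g_def S(2))
    have "root_bag g - root_bag t = (root_bag p - root_bag t) \<union> (root_bag s - root_bag t)"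
      using g_root by auto
    then have cg: "card (root_bag g - root_bag t)
        \<le> card (root_bag p - root_bag t) + card (root_bag s - root_bag t)"
      by (simp add: card_Un_le)
    have "card (root_bag t) \<le> c" using Attach.prems root_in_bags[of t] by auto
    moreover have "card (root_bag g) \<le> card (root_bag t) + card (root_bag g - root_bag t)"
    proof -
      have "finite (root_bag t \<union> (root_bag g - root_bag t))"
        using fin sub pV g_root by (metis finite_Diff finite_UnI finite_subset)
      then have "card (root_bag g) \<le> card (root_bag t \<union> (root_bag g - root_bag t))"
        by (intro card_mono) auto
      then show ?thesis
        using card_Un_le[of "root_bag t" "root_bag g - root_bag t"] by linarith
    qed
    ultimately have cg2: "card (root_bag g) \<le> c + 2 * q" using cg False T(6) by linarith
    have g_bags: "card X \<le> c + 2 * q" if X: "X \<in> bags g" for X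
    proof (cases "X = root_bag g")
      case True
      then show ?thesis using cg2 by simp
    next
      case False
      then show ?thesis
        using X bags_glue[of X p s] T(7)[of X] S(5)[of X] g_root unfolding g_def by auto
    qed
    have g_int: "\<Union>(bags t') \<inter> \<Union>(bags g) \<subseteq> root_bag t \<inter> root_bag g"
      unfolding g_V g_root using tp_int t's_int by blast
    have un: "\<Union>(bags t') \<union> \<Union>(bags g) = ?V \<union> ?W" using T(4) g_V by auto
    have ord: "q * (order t' + order g) + card (root_bag g - root_bag t)
        \<le> card (?V \<union> ?W - root_bag t) + 2 * q"
    proof -
      have "q * order p + q * order s = q * order g + q"
        using order_glue[of p s] unfolding g_def by (metis add_mult_distrib2 mult.right_neutral)
      then show ?thesis
        using T(9) S(7) VWcard cg by (simp add: algebra_simps)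
    qed
    have sp: "spread t' v + spread g v \<le> spread t v + spread u v" for v
      using spread_glue[of p s v] T(8)[of v] S(6)[of v] unfolding g_def by linarith
    have cov: "\<exists>Y\<in>bags t' \<union> bags g. X \<subseteq> Y" if "X \<in> bags t \<union> bags u" for X
    proof -
      have "\<exists>Y\<in>bags t' \<union> bags p \<union> bags s. X \<subseteq> Y"
        using that T(10)[of X] S(8)[of X] by blast
      then obtain Y where Y: "Y \<in> bags t' \<or> Y \<in> bags p \<union> bags s" "X \<subseteq> Y" by blast
      then show ?thesis using bags_glue_covers[of Y p s] unfolding g_def by blast
    qed
    show ?thesis
    proof (cases "card (root_bag g - root_bag t) < q")
      case True
      have "\<forall>X\<in>bags t' \<union> bags g. card X \<le> c + 2 * q"
        using T(7) g_bags by blast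
      then have "compression c q (Attach t u) t' g"
        unfolding compression_def
        using T(1,3) g_coh un g_int ord sp cov True by simp
      then show ?thesis by blast
    next
      case nlt: False
      \<comment> \<open>The merged part has reached \<open>q\<close> new vertices. It is closed, and
        these vertices pay for the extra node of the fresh empty pending part.\<close>
      have "compression c q (Attach t u) (Attach t' g) (Bag {})"
        unfolding compression_def
      proof (intro conjI allI ballI)
        show "coherent (Attach t' g)"
          using T(1,3) g_coh g_int by simp
        show "q * (order (Attach t' g) + order (Bag {}))
            + card (root_bag (Bag {}) - root_bag (Attach t u))
          \<le> card (\<Union>(bags (Attach t u)) - root_bag (Attach t u)) + 2 * q"
          using ord nlt by (simp add: algebra_simps)
        show "\<exists>Y\<in>bags (Attach t' g) \<union> bags (Bag {}). X \<subseteq> Y" if "X \<in> bags (Attach t u)" for X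
          using cov[of X] that by auto
        show "card X \<le> c + 2 * q" if "X \<in> bags (Attach t' g) \<union> bags (Bag {})" for X
          using that T(7)[of X] g_bags[of X] by auto
      qed (use T(3) un sp assms(4) in simp_all)
      then show ?thesis by blast
    qed
  qed
qed

text \<open>The root has no parent bag to be charged against, so the vertices of its own bag pay for
  it. For this the root bag must have at least \<open>q\<close> vertices.\<close>

lemma compress:
  assumes "coherent t" "finite (\<Union>(bags t))" "\<forall>X\<in>bags t. card X \<le> c" "0 < q"
    "q \<le> card (root_bag t)"
  obtains s where "coherent s" "\<Union>(bags s) = \<Union>(bags t)" "\<And>X. X \<in> bags s \<Longrightarrow> card X \<le> c + 2 * q"
    "\<And>v. spread s v \<le> spread t v" "q * order s \<le> card (\<Union>(bags t))"
    "\<And>X. X \<in> bags t \<Longrightarrow> \<exists>Y\<in>bags s. X \<subseteq> Y"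
proof -
  obtain t' p where tp: "compression c q t t' p"
    using compression_exists assms by blast
  define s where "s = glue t' p"
  note S = compression_glue[OF tp assms(2,3), folded s_def]
  have sub: "root_bag s \<subseteq> \<Union>(bags t)" using root_subset_bags[of s] S(2) by auto
  then have "card (\<Union>(bags t)) = card (\<Union>(bags t) - root_bag s) + card (root_bag s)"
    using assms(2) by (metis card_Diff_subset card_mono finite_subset le_add_diff_inverse2)
  moreover have "card (root_bag t) \<le> card (root_bag s)"
    using S(3) sub assms(2) by (meson card_mono finite_subset)
  ultimately have "q * order s \<le> card (\<Union>(bags t))"
    using S(7) assms(5) by linarith
  then show thesis using that S by blast
qed

section \<open>Low spread from balanced separations\<close>

definition nbrs :: "('a \<times> 'a) set \<Rightarrow> 'a \<Rightarrow> 'a set" where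
  "nbrs E v = {w. (v, w) \<in> E}"

definition separation :: "('a \<times> 'a) set \<Rightarrow> 'a set \<Rightarrow> 'a set \<Rightarrow> 'a set \<Rightarrow> bool" where
  "separation E V X Y \<longleftrightarrow>
     X \<union> Y = V \<and> (\<forall>x\<in>X - Y. \<forall>y\<in>Y - X. (x, y) \<notin> E \<and> (y, x) \<notin> E)"

text \<open>The balanced separator property of graphs of small treewidth. It is required for all
  \<open>S\<close>, so that one fixed graph serves every instance of the recursion.\<close>

definition separable :: "('a \<times> 'a) set \<Rightarrow> 'a set \<Rightarrow> nat \<Rightarrow> bool" where
  "separable E V m \<longleftrightarrow> (\<forall>S\<subseteq>V. \<exists>X Y. separation E V X Y \<and> card (X \<inter> Y) \<le> m \<and>
     3 * card (S - X) \<le> 2 * card S \<and> 3 * card (S - Y) \<le> 2 * card S)"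

definition decomposes :: "('a \<times> 'a) set \<Rightarrow> 'a set \<Rightarrow> 'a bagtree \<Rightarrow> bool" where
  "decomposes E V t \<longleftrightarrow> coherent t \<and> \<Union>(bags t) = V \<and>
     (\<forall>(v, w)\<in>E. \<exists>X\<in>bags t. v \<in> X \<and> w \<in> X)"

text \<open>
  One separation brings a set of size at most \<open>16m\<close> below \<open>12m\<close>; two and three separations
  suffice for sizes up to \<open>18m\<close> and \<open>24m\<close>. Each one costs \<open>m\<close> vertices in the root bag.
\<close>

definition slack :: "nat \<Rightarrow> nat \<Rightarrow> nat" where
  "slack m s = (if s \<le> 12 * m then 0 else if s \<le> 16 * m then m else if s \<le> 18 * m then 2 * m else 3 * m)"

text \<open>In each range of \<open>s\<close> the slacks of \<open>a\<close> and \<open>b\<close>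
  add up to at most \<open>slack m s - m\<close>, and \<open>x \<le> m\<close> does the rest. For
  \<open>s \<le> 16 * m\<close> both parts are at most \<open>12 * m\<close>. For
  \<open>s \<le> 18 * m\<close> both are at most \<open>13 * m\<close>, and since their sum is at
  most \<open>20 * m\<close> only one can exceed \<open>12 * m\<close>. Otherwise both are at most
  \<open>17 * m\<close> with sum at most \<open>26 * m\<close>, so if one exceeds
  \<open>16 * m\<close> then the other has no slack.\<close>

lemma slack_split:
  assumes "12 * m < s" "s \<le> 24 * m" "3 * a \<le> 2 * s + 3 * m" "3 * b \<le> 2 * s + 3 * m"
    "a + b \<le> s + 2 * x" "x \<le> m"
  shows "a \<le> 24 * m" "b \<le> 24 * m" "a + slack m a + (b + slack m b) \<le> s + slack m s + x"
  using assms unfolding slack_def by (auto split: if_splits)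

lemma separable_subset:
  assumes "separable E V m" "E' \<subseteq> E" "V' \<subseteq> V" "S \<subseteq> V'" "finite V"
  obtains X Y where "separation E' V' X Y" "card (X \<inter> Y) \<le> m"
     "3 * card (S - X) \<le> 2 * card S" "3 * card (S - Y) \<le> 2 * card S"
proof -
  obtain X Y where XY: "separation E V X Y" "card (X \<inter> Y) \<le> m"
     "3 * card (S - X) \<le> 2 * card S" "3 * card (S - Y) \<le> 2 * card S"
    using assms unfolding separable_def by (meson subset_trans)
  have fin: "finite (X \<inter> Y)" using XY(1) assms(5) unfolding separation_def by auto
  show thesis
  proof
    show "separation E' V' (X \<inter> V') (Y \<inter> V')"
      using XY(1) assms(2,3) unfolding separation_def by blast
    have "card ((X \<inter> V') \<inter> (Y \<inter> V')) \<le> card (X \<inter> Y)"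
      by (rule card_mono[OF fin]) auto
    then show "card ((X \<inter> V') \<inter> (Y \<inter> V')) \<le> m" using XY(2) by simp
    have "S - X \<inter> V' = S - X" "S - Y \<inter> V' = S - Y" using assms(4) by auto
    then show "3 * card (S - X \<inter> V') \<le> 2 * card S" "3 * card (S - Y \<inter> V') \<le> 2 * card S"
      using XY by simp_all
  qed
qed

text \<open>The constant \<open>27 * m\<close> is the limit \<open>24 * m\<close> on the prescribed
  set plus the largest slack \<open>3 * m\<close>. The spread is measured against the arcs of the
  current instance, so each arc deleted on the way down can pay for one occurrence higher
  up.\<close>

definition low_spread :: "nat \<Rightarrow> ('a \<times> 'a) set \<Rightarrow> 'a set \<Rightarrow> 'a set \<Rightarrow> 'a bagtree \<Rightarrow> bool" where
  "low_spread m E V S t \<longleftrightarrow> decomposes E V t \<and> S \<subseteq> root_bag t \<and>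
     card (root_bag t) \<le> card S + slack m (card S) \<and> (\<forall>X\<in>bags t. card X \<le> 27 * m) \<and>
     (\<forall>v. spread t v \<le> card (nbrs E v) + 1)"

text \<open>The case of a small \<open>S\<close>, with the induction hypothesis as the assumption
  \<open>IH\<close>. The measure drops because the child's root set contains a vertex outside
  \<open>S\<close>, while the vertex set does not grow.\<close>

lemma low_spread_step:
  fixes E :: "('a \<times> 'a) set"
  assumes fin: "finite V" and E: "sym E" "E \<subseteq> V \<times> V" and m: "0 < m"
    and S: "S \<subseteq> V" "card S \<le> 12 * m"
    and IH: "\<And>E' V' S'. E' \<subseteq> E \<Longrightarrow> V' \<subseteq> V \<Longrightarrow> S' \<subseteq> V' \<Longrightarrow> card S' \<le> 24 * m \<Longrightarrow>
      sym E' \<Longrightarrow> E' \<subseteq> V' \<times> V' \<Longrightarrow>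
      card V' + card (V' - S') < card V + card (V - S) \<Longrightarrow> \<exists>t. low_spread m E' V' S' t"
  shows "\<exists>t. low_spread m E V S t"
proof (cases "V = S")
  case True
  then have "low_spread m E V S (Bag S)"
    using E S unfolding low_spread_def decomposes_def by auto
  then show ?thesis by blast
next
  case False
  then obtain z where z: "z \<in> V - S" using S by blast
  have finN: "finite (nbrs E v)" for v
  proof -
    have "nbrs E v \<subseteq> V" using E(2) unfolding nbrs_def by auto
    then show ?thesis using fin by (rule finite_subset)
  qed
  have finS: "finite S" using S fin by (auto intro: finite_subset)
  define S0 where "S0 = {v\<in>S. \<exists>w. w \<in> V - S \<and> (v, w) \<in> E}"
  have "\<forall>v\<in>S0. \<exists>w. w \<in> V - S \<and> (v, w) \<in> E"
    unfolding S0_def by simp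
  then obtain f where f: "\<And>v. v \<in> S0 \<Longrightarrow> f v \<in> V - S \<and> (v, f v) \<in> E"
    by metis
  \<comment> \<open>If no vertex of \<open>S\<close> has a neighbour outside, any outside vertex
    \<open>z\<close> is taken, so that \<open>W\<close> is non-empty and the measure
    decreases.\<close>
  define W where "W = (if S0 = {} then {z} else f ` S0)"
  have S0: "S0 \<subseteq> S" unfolding S0_def by auto
  have finS0: "finite S0" using S0 finS by (rule finite_subset)
  have W: "W \<subseteq> V - S" "W \<noteq> {}" using z f unfolding W_def by auto
  have "card W \<le> max 1 (card S0)"
    unfolding W_def using card_image_le[OF finS0, of f] by auto
  moreover have "card S0 \<le> 12 * m" using card_mono[OF finS S0] S(2) by simp
  ultimately have "card (S0 \<union> W) \<le> 24 * m"
    using card_Un_le[of S0 W] m by linarith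
  define V' where "V' = V - (S - S0)"
  define S' where "S' = S0 \<union> W"
  \<comment> \<open>Arcs inside \<open>S'\<close> are covered by the root bag of the child. For
    \<open>v\<close> in \<open>S0\<close> this deletes at least the arc
    \<open>(v, f v)\<close>.\<close>
  define E' where "E' = {(u, v)\<in>E. u \<in> V' \<and> v \<in> V' \<and> \<not> (u \<in> S' \<and> v \<in> S')}"
  have "\<exists>t. low_spread m E' V' S' t"
  proof (rule IH)
    show "E' \<subseteq> E" "V' \<subseteq> V" "E' \<subseteq> V' \<times> V'" unfolding E'_def V'_def by auto
    show "S' \<subseteq> V'" using S0 W S unfolding S'_def V'_def by auto
    show "card S' \<le> 24 * m" unfolding S'_def by fact
    show "sym E'" using E(1) unfolding E'_def sym_def by auto
    have "card V' \<le> card V" unfolding V'_def using fin by (intro card_mono) auto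
    moreover have "card (V' - S') < card (V - S)"
    proof (rule psubset_card_mono)
      show "finite (V - S)" using fin by auto
      show "V' - S' \<subset> V - S" using W unfolding V'_def S'_def by auto
    qed
    ultimately show "card V' + card (V' - S') < card V + card (V - S)" by simp
  qed
  then obtain t where t: "low_spread m E' V' S' t" ..
  note T = t[unfolded low_spread_def decomposes_def]
  have "low_spread m E V S (Attach (Bag S) t)"
    unfolding low_spread_def decomposes_def
  proof (intro conjI)
    show "coherent (Attach (Bag S) t)"
      using T unfolding V'_def S'_def by auto
    show "\<Union>(bags (Attach (Bag S) t)) = V"
      using T S S0 unfolding V'_def by auto
    have "\<exists>X\<in>bags (Attach (Bag S) t). u \<in> X \<and> v \<in> X" if uv: "(u, v) \<in> E" for u v
    proof -
      have V: "u \<in> V" "v \<in> V" "(v, u) \<in> E" using uv E by (auto dest: symD)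
      \<comment> \<open>If one end of an edge lies in \<open>S\<close> and the other does not, then
        the former is in \<open>S0\<close> and hence survives in \<open>V'\<close>.\<close>
      consider "u \<in> S" "v \<in> S" | "u \<in> V'" "v \<in> V'"
        using V uv unfolding V'_def S0_def by blast
      then show ?thesis
      proof cases
        case 1
        then show ?thesis by auto
      next
        case 2
        show ?thesis
        proof (cases "u \<in> S' \<and> v \<in> S'")
          case True
          then have "u \<in> root_bag t \<and> v \<in> root_bag t" using T by auto
          then show ?thesis using root_in_bags[of t] by auto
        next
          case False
          then have "(u, v) \<in> E'" using 2 uv unfolding E'_def by auto
          then show ?thesis using T by fastforce
        qed
      qed
    qed
    then show "\<forall>(u, v)\<in>E. \<exists>X\<in>bags (Attach (Bag S) t). u \<in> X \<and> v \<in> X" by auto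
    show "\<forall>v. spread (Attach (Bag S) t) v \<le> card (nbrs E v) + 1"
    proof
      fix v
      have le: "spread t v \<le> card (nbrs E' v) + 1" using T by auto
      have sub: "nbrs E' v \<subseteq> nbrs E v" unfolding nbrs_def E'_def by auto
      consider "v \<notin> S" | "v \<in> S" "v \<notin> S0" | "v \<in> S0" by blast
      then show "spread (Attach (Bag S) t) v \<le> card (nbrs E v) + 1"
      proof cases
        case 1
        then show ?thesis using le card_mono[OF finN sub] by simp
      next
        case 2
        then have "v \<notin> \<Union>(bags t)" using T unfolding V'_def by auto
        then show ?thesis using spread_eq_0[of v t] by simp
      next
        case 3
        then have "f v \<in> nbrs E v" "f v \<notin> nbrs E' v"
          using f[OF 3] unfolding nbrs_def E'_def S'_def W_def by auto
        then have "card (nbrs E' v) < card (nbrs E v)"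
          using sub by (intro psubset_card_mono finN) auto
        then show ?thesis using le 3 S0 by auto
      qed
    qed
  qed (use T S in auto)
  then show ?thesis by blast
qed

text \<open>Induction on \<open>card V + card (V - S)\<close>: growing the prescribed set decreases
  the second summand, splitting along a separation decreases the first, and neither increases the
  other.\<close>

lemma low_spread_exists:
  fixes E :: "('a \<times> 'a) set"
  assumes "separable E0 V0 m" "finite V0" "0 < m"
    and "E \<subseteq> E0" "V \<subseteq> V0" "sym E" "E \<subseteq> V \<times> V" "S \<subseteq> V" "card S \<le> 24 * m"
  shows "\<exists>t. low_spread m E V S t"
  using assms(4-9)
proof (induction "card V + card (V - S)" arbitrary: V E S rule: less_induct)
  case less
  have fin: "finite V" using less.prems(2) assms(2) by (rule finite_subset)
  show ?case
  proof (cases "card S \<le> 12 * m")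
    case True
    show ?thesis
    proof (rule low_spread_step[OF fin less.prems(3,4) assms(3) less.prems(5) True])
      fix E' V' S'
      assume "E' \<subseteq> E" "V' \<subseteq> V" "S' \<subseteq> V'" "card S' \<le> 24 * m" "sym E'" "E' \<subseteq> V' \<times> V'"
        and "card V' + card (V' - S') < card V + card (V - S)"
      then show "\<exists>t. low_spread m E' V' S' t"
        using less.hyps[of V' S' E'] less.prems(1,2) by blast
    qed
  next
    case False
    obtain X Y where XY: "separation E V X Y" "card (X \<inter> Y) \<le> m"
     "3 * card (S - X) \<le> 2 * card S" "3 * card (S - Y) \<le> 2 * card S"
      using separable_subset[OF assms(1) less.prems(1,2,5) assms(2)] by blast
    have finS: "finite S" using less.prems(5) fin by (rule finite_subset)
    have V: "X \<union> Y = V" using XY(1) unfolding separation_def by auto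
    then have finXY: "finite X" "finite Y" using fin by auto
    define A where "A = (S \<inter> X) \<union> (X \<inter> Y)"
    define B where "B = (S \<inter> Y) \<union> (X \<inter> Y)"
    have cA: "card A \<le> card (S - Y) + card (X \<inter> Y)"
    proof -
      have "A = (S - Y) \<union> (X \<inter> Y)" using V less.prems(5) unfolding A_def by auto
      then show ?thesis by (simp add: card_Un_le)
    qed
    have cB: "card B \<le> card (S - X) + card (X \<inter> Y)"
    proof -
      have "B = (S - X) \<union> (X \<inter> Y)" using V less.prems(5) unfolding B_def by auto
      then show ?thesis by (simp add: card_Un_le)
    qed
      have "card ((S - Y) \<union> (S - X)) = card (S - Y) + card (S - X)"
      using finS V less.prems(5) by (intro card_Un_disjoint) auto
    moreover have "card ((S - Y) \<union> (S - X)) \<le> card S"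
      using finS by (intro card_mono) auto
    ultimately have cS: "card (S - Y) + card (S - X) \<le> card S" by simp
    have "card S \<le> card (S \<inter> X) + card (S - X)"
      by (metis Int_Diff_Un card_Un_le)
    moreover have "card (S \<inter> X) \<le> card (X - Y) + card (X \<inter> Y)"
    proof -
      have "card (S \<inter> X) \<le> card X" using finXY by (intro card_mono) auto
      also have "\<dots> \<le> card (X - Y) + card (X \<inter> Y)" by (metis Int_Diff_Un add.commute card_Un_le)
      finally show ?thesis .
    qed
    \<comment> \<open>If \<open>X - Y\<close> were empty, \<open>S\<close> would have at most
      \<open>m\<close> vertices in \<open>X\<close> and two thirds of its size outside, which is
      impossible above \<open>12 * m\<close>.\<close>
    ultimately have nX: "0 < card (X - Y)" using XY(2,3) False assms(3) by linarith
    have "card S \<le> card (S \<inter> Y) + card (S - Y)"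
      by (metis Int_Diff_Un card_Un_le)
    moreover have "card (S \<inter> Y) \<le> card (Y - X) + card (X \<inter> Y)"
    proof -
      have "card (S \<inter> Y) \<le> card Y" using finXY by (intro card_mono) auto
      also have "\<dots> \<le> card (Y - X) + card (X \<inter> Y)"
        by (metis Int_Diff_Un Int_commute add.commute card_Un_le)
      finally show ?thesis .
    qed
    ultimately have nY: "0 < card (Y - X)" using XY(2,4) False assms(3) by linarith
    have SL: "card A \<le> 24 * m" "card B \<le> 24 * m"
      "card A + slack m (card A) + (card B + slack m (card B))
        \<le> card S + slack m (card S) + card (X \<inter> Y)"
      using slack_split[of m "card S" "card A" "card B" "card (X \<inter> Y)"]
        False less.prems(6) cA cB cS XY(2-4) by linarith+
    \<comment> \<open>Arcs inside \<open>X \<inter> Y\<close> are given to one side only, so the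
      degrees of a vertex in the two instances add up to at most its degree in
      \<open>E\<close>.\<close>
    define E1 where "E1 = E \<inter> X \<times> X"
    define E2 where "E2 = E \<inter> Y \<times> Y - X \<times> X"
    have sE: "sym E1" "sym E2" using less.prems(3) unfolding E1_def E2_def sym_def by auto
    have "\<exists>t. low_spread m E1 X A t"
    proof (rule less.hyps)
      have "card X < card V" using nY V fin
        by (intro psubset_card_mono) (auto simp: card_gt_0_iff)
      moreover have "card (X - A) \<le> card (V - S)"
        using V fin unfolding A_def by (intro card_mono) auto
      ultimately show "card X + card (X - A) < card V + card (V - S)" by simp
    qed (use sE V SL less.prems(1,2) in \<open>auto simp: E1_def A_def\<close>)
    then obtain t where t: "low_spread m E1 X A t" ..
    have "\<exists>t. low_spread m E2 Y B t"
    proof (rule less.hyps)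
      have "card Y < card V" using nX V fin
        by (intro psubset_card_mono) (auto simp: card_gt_0_iff)
      moreover have "card (Y - B) \<le> card (V - S)"
        using V fin unfolding B_def by (intro card_mono) auto
      ultimately show "card Y + card (Y - B) < card V + card (V - S)" by simp
    qed (use sE V SL less.prems(1,2) in \<open>auto simp: E2_def B_def\<close>)
    then obtain u where u: "low_spread m E2 Y B u" ..
    note T = t[unfolded low_spread_def decomposes_def]
    note U = u[unfolded low_spread_def decomposes_def]
    have XYsub: "X \<inter> Y \<subseteq> root_bag t \<inter> root_bag u" using T U unfolding A_def B_def by auto
    have rsub: "root_bag t \<subseteq> X" "root_bag u \<subseteq> Y"
      using root_subset_bags[of t] root_subset_bags[of u] T U by auto
    \<comment> \<open>The root bags share exactly the separator. Subtracting its size once cancels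
      the term \<open>card (X \<inter> Y)\<close> in \<open>SL(3)\<close>.\<close>
    have int: "root_bag t \<inter> root_bag u = X \<inter> Y" using XYsub rsub by auto
    have "card (root_bag t \<union> root_bag u) + card (root_bag t \<inter> root_bag u)
        = card (root_bag t) + card (root_bag u)"
      using rsub finXY by (metis card_Un_Int finite_subset)
    then have croot: "card (root_bag t \<union> root_bag u) \<le> card S + slack m (card S)"
      using SL(3) T U unfolding int by linarith
    have "slack m (card S) \<le> 3 * m" unfolding slack_def by auto
    then have croot': "card (root_bag t \<union> root_bag u) \<le> 27 * m"
      using croot less.prems(6) by linarith
    have "low_spread m E V S (glue t u)"
      unfolding low_spread_def decomposes_def
    proof (intro conjI)
      show "coherent (glue t u)"
        using T U XYsub by (intro coherent_glue) auto
      show "\<Union>(bags (glue t u)) = V" using T U V by simp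
      have "\<exists>Z\<in>bags (glue t u). v \<in> Z \<and> w \<in> Z" if vw: "(v, w) \<in> E" for v w
      proof -
        have "v \<in> V" "w \<in> V" using vw less.prems(4) by auto
        then have "(v, w) \<in> E1 \<or> (v, w) \<in> E2"
          using vw XY(1) V unfolding separation_def E1_def E2_def by blast
        then obtain Z where Z: "Z \<in> bags t \<union> bags u" "v \<in> Z" "w \<in> Z"
          using T U by fastforce
        then show ?thesis using bags_glue_covers[OF Z(1)] by blast
      qed
      then show "\<forall>(v, w)\<in>E. \<exists>Z\<in>bags (glue t u). v \<in> Z \<and> w \<in> Z" by auto
      show "S \<subseteq> root_bag (glue t u)"
      proof -
        have "A \<subseteq> root_bag t" "B \<subseteq> root_bag u" using T U by blast+
        then show ?thesis using V less.prems(5) unfolding A_def B_def by auto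
      qed
      show "card (root_bag (glue t u)) \<le> card S + slack m (card S)" using croot by simp
      show "\<forall>Z\<in>bags (glue t u). card Z \<le> 27 * m"
        using T U croot' by (auto dest!: bags_glue)
      show "\<forall>v. spread (glue t u) v \<le> card (nbrs E v) + 1"
      proof
        fix v
        have "nbrs E v \<subseteq> V" using less.prems(4) unfolding nbrs_def by auto
        then have finN: "finite (nbrs E v)" using fin by (rule finite_subset)
        have sub: "nbrs E1 v \<union> nbrs E2 v \<subseteq> nbrs E v" "nbrs E1 v \<inter> nbrs E2 v = {}"
          unfolding nbrs_def E1_def E2_def by auto
        then have "card (nbrs E1 v \<union> nbrs E2 v) = card (nbrs E1 v) + card (nbrs E2 v)"
          using finN by (intro card_Un_disjoint) (auto intro: finite_subset)
        then have N: "card (nbrs E1 v) + card (nbrs E2 v) \<le> card (nbrs E v)"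
          using card_mono[OF finN sub(1)] by simp
        have le: "spread t v \<le> card (nbrs E1 v) + 1" "spread u v \<le> card (nbrs E2 v) + 1"
          using T U by auto
        \<comment> \<open>A separator vertex gets the summand 1 from both sides, but loses one
          occurrence when the roots are identified.\<close>
        consider "v \<in> X \<inter> Y" | "v \<notin> X" | "v \<notin> Y" by blast
        then show "spread (glue t u) v \<le> card (nbrs E v) + 1"
        proof cases
          case 1
          then show ?thesis using spread_glue[of t u v] le N int by auto
        next
          case 2
          then have "spread t v = 0" using T by (intro spread_eq_0) auto
          then show ?thesis using spread_glue[of t u v] le N by linarith
        next
          case 3
          then have "spread u v = 0" using U by (intro spread_eq_0) auto
          then show ?thesis using spread_glue[of t u v] le N by linarith
        qed
      qed
    qed
    then show ?thesis by blast
  qed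
qed

section \<open>Balanced separations from tree-decompositions\<close>

text \<open>Connectedness of the induced subgraph when \<open>R\<close> is symmetric. The empty set
  is linked, which keeps the property stable under deleting the last node.\<close>

definition linked :: "'b rel \<Rightarrow> 'b set \<Rightarrow> bool" where
  "linked R W \<longleftrightarrow> (\<forall>x\<in>W. \<forall>y\<in>W. (x, y) \<in> (Restr R W)\<^sup>*)"

lemma rtrancl_on_Restr: "(x, y) \<in> rtrancl_on W r \<longleftrightarrow> x \<in> W \<and> (x, y) \<in> (Restr r W)\<^sup>*"
proof
  assume "(x, y) \<in> rtrancl_on W r"
  then show "x \<in> W \<and> (x, y) \<in> (Restr r W)\<^sup>*"
  proof induction
    case (step a b)
    then show ?case by (auto intro: converse_rtrancl_into_rtrancl)
  qed auto
next
  assume "x \<in> W \<and> (x, y) \<in> (Restr r W)\<^sup>*"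
  then have "(x, y) \<in> (Restr r W)\<^sup>*" "x \<in> W" by auto
  then show "(x, y) \<in> rtrancl_on W r"
    by (induction rule: rtrancl_induct) (auto intro: rtrancl_on_into_rtrancl_on)
qed

lemma connected_iff_linked:
  assumes "verts H = W" "mk_symmetric H = \<lparr>pverts = W, parcs = Restr R W\<rparr>"
  shows "connected H \<longleftrightarrow> W \<noteq> {} \<and> linked R W"
proof -
  have "Restr (Restr R W) W = Restr R W" by auto
  then show ?thesis
    using assms
    unfolding connected_def strongly_connected_def reachable_def linked_def
    by (auto simp: rtrancl_on_Restr)
qed

lemma connected_induced_iff:
  assumes "sym (parcs T)" "W \<subseteq> pverts T"
  shows "connected (with_proj T \<restriction> W) \<longleftrightarrow> W \<noteq> {} \<and> linked (parcs T) W"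
proof (rule connected_iff_linked)
  show "mk_symmetric (with_proj T \<restriction> W) = \<lparr>pverts = W, parcs = Restr (parcs T) W\<rparr>"
    using assms(1) unfolding mk_symmetric_def by (auto dest: symD)
qed simp

lemma connected_graph_iff:
  assumes "pair_graph T"
  shows "connected (with_proj T) \<longleftrightarrow> pverts T \<noteq> {} \<and> linked (parcs T) (pverts T)"
proof (rule connected_iff_linked)
  interpret pair_graph T by fact
  have "sym (parcs T)" using pair_sym_arcs unfolding symmetric_def by simp
  then show "mk_symmetric (with_proj T) = \<lparr>pverts = pverts T, parcs = Restr (parcs T) (pverts T)\<rparr>"
    unfolding mk_symmetric_def using in_arcsD1 in_arcsD2 by (auto dest: symD)
qed simp

text \<open>At most one neighbour inside \<open>W\<close>; isolated nodes count as leaves.\<close>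

definition leaf_in :: "'b rel \<Rightarrow> 'b set \<Rightarrow> 'b \<Rightarrow> bool" where
  "leaf_in R W l \<longleftrightarrow> l \<in> W \<and> (\<forall>p\<in>W. \<forall>q\<in>W. (l, p) \<in> R \<longrightarrow> (l, q) \<in> R \<longrightarrow> p = q)"

text \<open>A walk through a leaf enters and leaves it by the same neighbour, so the detour can be
  cut out.\<close>

lemma linked_remove_leaf:
  assumes "sym R" "irrefl R" "leaf_in R W l" "linked R W"
  shows "linked R (W - {l})"
  unfolding linked_def
proof (intro ballI)
  fix x y assume x: "x \<in> W - {l}" and y: "y \<in> W - {l}"
  let ?R = "(Restr R (W - {l}))\<^sup>*"
  have "(x, y) \<in> (Restr R W)\<^sup>*" using assms(4) x y unfolding linked_def by auto
  \<comment> \<open>The induction also covers walks that currently end in \<open>l\<close>: they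
    remember a neighbour of \<open>l\<close> reached while avoiding \<open>l\<close>.\<close>
  then have "(y \<noteq> l \<longrightarrow> (x, y) \<in> ?R) \<and> (y = l \<longrightarrow> (\<exists>p\<in>W. (l, p) \<in> R \<and> (x, p) \<in> ?R))"
  proof (induction rule: rtrancl_induct)
    case base
    then show ?case using x by auto
  next
    case (step z w)
    have zw: "(z, w) \<in> R" "z \<in> W" "w \<in> W" "z \<noteq> w"
      using step.hyps assms(2) by (auto simp: irrefl_def)
    consider "z = l" | "w = l" | "z \<noteq> l" "w \<noteq> l" by blast
    then show ?case
    proof cases
      case 1
      then obtain p where "p \<in> W" "(l, p) \<in> R" "(x, p) \<in> ?R" using step.IH by auto
      then show ?thesis using 1 zw assms(3) unfolding leaf_in_def by blast
    next
      case 2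
      then show ?thesis using zw step.IH assms(1) by (auto dest: symD)
    next
      case 3
      then have "(z, w) \<in> Restr R (W - {l})" using zw by auto
      then show ?thesis using 3 step.IH by (auto intro: rtrancl_into_rtrancl)
    qed
  qed
  then show "(x, y) \<in> ?R" using y by auto
qed

lemma linked_neighbour:
  assumes "linked R W" "l \<in> W" "j \<in> W" "j \<noteq> l"
  shows "\<exists>p\<in>W. (l, p) \<in> R"
proof -
  have "(l, j) \<in> (Restr R W)\<^sup>*" using assms unfolding linked_def by auto
  then show ?thesis using assms(4) by (cases rule: converse_rtranclE) auto
qed

text \<open>
  The sets \<open>D x\<close> are bags enlarged by private vertices, \<open>D x - B x\<close>, which accumulate the
  contents of deleted leaves.
\<close>

definition bag_family ::
    "'b rel \<Rightarrow> 'b set \<Rightarrow> ('b \<Rightarrow> 'a set) \<Rightarrow> ('b \<Rightarrow> 'a set) \<Rightarrow> ('a \<times> 'a) set \<Rightarrow> 'a set \<Rightarrow> bool" where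
  "bag_family R U D B E V \<longleftrightarrow>
     (\<forall>x\<in>U. B x \<subseteq> D x) \<and> (\<forall>x\<in>U. \<forall>y\<in>U. x \<noteq> y \<longrightarrow> D x \<inter> D y \<subseteq> B x) \<and>
     \<Union>(D ` U) = V \<and> (\<forall>(v, w)\<in>E. \<exists>x\<in>U. v \<in> D x \<and> w \<in> D x) \<and>
     (\<forall>v\<in>V. linked R {x\<in>U. v \<in> D x})"

lemma bag_familyD:
  assumes "bag_family R U D B E V"
  shows "\<And>x. x \<in> U \<Longrightarrow> B x \<subseteq> D x"
    "\<And>x y v. x \<in> U \<Longrightarrow> y \<in> U \<Longrightarrow> v \<in> D x \<Longrightarrow> v \<in> D y \<Longrightarrow> x = y \<or> v \<in> B x"
    "\<Union>(D ` U) = V"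
    "\<And>v w. (v, w) \<in> E \<Longrightarrow> \<exists>x\<in>U. v \<in> D x \<and> w \<in> D x"
    "\<And>v. v \<in> V \<Longrightarrow> linked R {x\<in>U. v \<in> D x}"
proof -
  note F = assms[unfolded bag_family_def]
  show "B x \<subseteq> D x" if "x \<in> U" for x using F that by simp
  show "x = y \<or> v \<in> B x" if "x \<in> U" "y \<in> U" "v \<in> D x" "v \<in> D y" for x y v
  proof -
    have "\<forall>x\<in>U. \<forall>y\<in>U. x \<noteq> y \<longrightarrow> D x \<inter> D y \<subseteq> B x" using F by simp
    then show ?thesis using that by blast
  qed
  show "\<Union>(D ` U) = V" using F by simp
  show "\<exists>x\<in>U. v \<in> D x \<and> w \<in> D x" if vw: "(v, w) \<in> E" for v w
  proof -
    have "\<forall>(v, w)\<in>E. \<exists>x\<in>U. v \<in> D x \<and> w \<in> D x" using F by simp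
    then show ?thesis using vw by blast
  qed
  show "linked R {x\<in>U. v \<in> D x}" if "v \<in> V" for v using F that by simp
qed

text \<open>A private vertex of \<open>D x\<close> lies in no other set of the family, so all its
  edges stay inside \<open>D x\<close>, and \<open>B x\<close> separates it from the rest.\<close>

lemma bag_family_cut:
  assumes "bag_family R U D B E V" "sym E" "x \<in> U"
  shows "separation E V (D x) (V - (D x - B x))" "D x \<inter> (V - (D x - B x)) = B x"
proof -
  note F = bag_familyD[OF assms(1)]
  have DV: "D x \<subseteq> V" "B x \<subseteq> D x" using F(1,3) assms(3) by auto
  then show "D x \<inter> (V - (D x - B x)) = B x" by auto
  have "w \<in> D x" if v: "v \<in> D x - B x" and vw: "(v, w) \<in> E" for v w
  proof -
    obtain y where y: "y \<in> U" "v \<in> D y" "w \<in> D y" using F(4)[OF vw] by blast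
    then have "y = x" using F(2)[OF assms(3) y(1) _ y(2)] v by blast
    then show ?thesis using y by simp
  qed
  then show "separation E V (D x) (V - (D x - B x))"
    unfolding separation_def using DV assms(2) by (blast dest: symD)
qed

text \<open>Leaves are deleted one at a time and their private contents pushed to a neighbour, while
  every private part holds at most a third of \<open>S\<close>. The first time this would fail, a
  balanced separation appears. Acyclicity enters only through the existence of leaves.\<close>

lemma bag_family_separation:
  assumes "finite U" "U \<noteq> {}" "sym R" "irrefl R"
    and "\<And>W. W \<subseteq> U \<Longrightarrow> W \<noteq> {} \<Longrightarrow> \<exists>l. leaf_in R W l"
    and "bag_family R U D B E V" "\<And>x. x \<in> U \<Longrightarrow> card (B x) \<le> m"
    and "finite V" "sym E" "S \<subseteq> V" "\<And>x. x \<in> U \<Longrightarrow> 3 * card (S \<inter> (D x - B x)) \<le> card S"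
  shows "\<exists>X Y. separation E V X Y \<and> card (X \<inter> Y) \<le> m \<and>
     3 * card (S - X) \<le> 2 * card S \<and> 3 * card (S - Y) \<le> 2 * card S"
  using assms(1,2,5-7,11)
proof (induction "card U" arbitrary: U D rule: less_induct)
  case less
  have finS: "finite S" using assms(8,10) by (auto intro: finite_subset)
  note F = bag_familyD[OF less.prems(4)]
  have cut: ?case if "bag_family R U' D' B E V" "x \<in> U'" "x \<in> U"
    and "3 * card (S \<inter> (D' x - B x)) \<le> 2 * card S" "3 * card (S - D' x) \<le> 2 * card S" for U' D' x
  proof (intro exI conjI)
    show "separation E V (D' x) (V - (D' x - B x))"
      using bag_family_cut[OF that(1) assms(9) that(2)] by simp
    show "card (D' x \<inter> (V - (D' x - B x))) \<le> m"
      using bag_family_cut[OF that(1) assms(9) that(2)] less.prems(5) that(3) by simp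
    have "S - (V - (D' x - B x)) = S \<inter> (D' x - B x)" using assms(10) by auto
    then show "3 * card (S - (V - (D' x - B x))) \<le> 2 * card S" using that(4) by simp
  qed (use that in simp)
  have compl: "card (S - X) = card S - card (S \<inter> X)" for X
    using finS by (metis card_Diff_subset_Int finite_Int)
  obtain l where leaf: "leaf_in R U l" using less.prems(2,3) by blast
  then have lU: "l \<in> U" unfolding leaf_in_def by simp
  show ?case
  proof (cases "U = {l}")
    case True
    then have "D l = V" using F(3) by auto
    then have "card (S - D l) = 0" using assms(10) by (simp add: Diff_eq_empty_iff[THEN iffD2])
    then show ?thesis using cut[OF less.prems(4) lU lU] less.prems(6)[OF lU] by simp
  next
    case False
    \<comment> \<open>The node \<open>p\<close> is the neighbour of the leaf. An isolated leaf
      shares no vertex with other nodes, so any other node will do.\<close>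
    have "\<exists>p\<in>U. p \<noteq> l \<and> (\<forall>y\<in>U. y \<noteq> l \<longrightarrow> D l \<inter> D y \<subseteq> D p)"
    proof (cases "\<exists>p\<in>U. (l, p) \<in> R")
      case True
      then obtain p where p: "p \<in> U" "(l, p) \<in> R" by auto
      have "v \<in> D p" if y: "y \<in> U" "y \<noteq> l" "v \<in> D l" "v \<in> D y" for y v
      proof -
        have "v \<in> V" using F(3) y by auto
        then have "linked R {x\<in>U. v \<in> D x}" by (rule F(5))
        from linked_neighbour[OF this, of l y] obtain p' where "p' \<in> U" "v \<in> D p'" "(l, p') \<in> R"
          using y lU by auto
        then show ?thesis using p leaf unfolding leaf_in_def by blast
      qed
      moreover have "p \<noteq> l" using p assms(4) by (auto simp: irrefl_def)
      ultimately show ?thesis using p by blast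
    next
      case no: False
      obtain p where p: "p \<in> U" "p \<noteq> l" using False lU by blast
      have False if y: "y \<in> U" "y \<noteq> l" "v \<in> D l" "v \<in> D y" for y v
      proof -
        have "v \<in> V" using F(3) y by auto
        then have "linked R {x\<in>U. v \<in> D x}" by (rule F(5))
        from linked_neighbour[OF this, of l y] show False
          using y lU no by auto
      qed
      then show ?thesis using p by blast
    qed
    then obtain p where p: "p \<in> U" "p \<noteq> l" "\<And>y. y \<in> U \<Longrightarrow> y \<noteq> l \<Longrightarrow> D l \<inter> D y \<subseteq> D p"
      by blast
    define P where "P = D l - D p"
    have Pl: "y = l" if "y \<in> U" "v \<in> D y" "v \<in> P" for y v
      using that p(3) unfolding P_def by blast
    have DlV: "D l \<subseteq> V" using F(3) lU by auto
    consider "2 * card S < 3 * card (S \<inter> P)"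
      | "card S < 3 * card (S \<inter> P)" "3 * card (S \<inter> P) \<le> 2 * card S"
      | "3 * card (S \<inter> P) \<le> card S" by linarith
    then show ?thesis
    proof cases
      case 1
      \<comment> \<open>More than two thirds of \<open>S\<close> lie in \<open>P\<close>: cutting at
        \<open>B l\<close> leaves less than a third outside \<open>D l\<close>, and the private part
        of \<open>l\<close> has at most a third by the invariant.\<close>
      have "card (S - D l) \<le> card (S - P)"
        using finS unfolding P_def by (intro card_mono) auto
      then have "3 * card (S - D l) \<le> 2 * card S" using 1 compl[of P] by linarith
      then show ?thesis using cut[OF less.prems(4) lU lU] less.prems(6)[OF lU] by simp
    next
      case 2
      have "card (S - D l) \<le> card (S - P)"
        using finS unfolding P_def by (intro card_mono) auto
      then have c1: "3 * card (S - D l) \<le> 2 * card S" using 2 compl[of P] by linarith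
      have "S - (V - P) = S \<inter> P" using assms(10) by auto
      then have c2: "3 * card (S - (V - P)) \<le> 2 * card S" using 2 by simp
      \<comment> \<open>Between one and two thirds of \<open>S\<close> lie in \<open>P\<close>: the
        cut is made along the tree edge, with separator \<open>D l \<inter> D p\<close>.\<close>
      have "D l \<inter> (V - P) \<subseteq> B p"
        using F(2)[OF p(1) lU] p(2) unfolding P_def by blast
      moreover have "finite (B p)" using F(1)[OF p(1)] F(3) p(1) assms(8) by (meson UN_upper finite_subset subset_trans)
      ultimately have c3: "card (D l \<inter> (V - P)) \<le> m"
        using less.prems(5)[OF p(1)] by (meson card_mono le_trans)
      have "w \<in> D l" if v: "v \<in> P" and vw: "(v, w) \<in> E" for v w
      proof -
        obtain y where y: "y \<in> U" "v \<in> D y" "w \<in> D y" using F(4)[OF vw] by blast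
        then have "y = l" using Pl[OF y(1,2)] v by blast
        then show ?thesis using y by simp
      qed
      then have "separation E V (D l) (V - P)"
        unfolding separation_def using DlV assms(9) P_def by (blast dest: symD)
      then show ?thesis using c1 c2 c3 by blast
    next
      case 3
      \<comment> \<open>At most a third of \<open>S\<close> lies in \<open>P\<close>: the leaf is
        deleted and \<open>P\<close> becomes private to \<open>p\<close>, whose private part then
        holds at most two thirds of \<open>S\<close>.\<close>
      define D' where "D' = D(p := D p \<union> P)"
      have D'simps: "D' p = D p \<union> P" "\<And>x. x \<noteq> p \<Longrightarrow> D' x = D x" unfolding D'_def by auto
      have F': "bag_family R (U - {l}) D' B E V"
        unfolding bag_family_def
      proof (intro conjI ballI)
        fix x assume "x \<in> U - {l}"
        then show "B x \<subseteq> D' x" using F(1)[of x] unfolding D'_def by auto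
      next
        fix x y assume xy: "x \<in> U - {l}" "y \<in> U - {l}"
        have "z \<notin> P" if "z \<in> D x \<or> z \<in> D y" for z using Pl xy that by blast
        then have "D' x \<inter> D' y \<subseteq> D x \<inter> D y" if "x \<noteq> y"
          using that D'simps by (cases "x = p"; cases "y = p") auto
        then show "x \<noteq> y \<longrightarrow> D' x \<inter> D' y \<subseteq> B x" using F(2)[of x y] xy by blast
      next
        have "\<Union>(D' ` (U - {l})) = \<Union>(D ` (U - {l})) \<union> P"
        proof -
          have "U - {l} = insert p (U - {l} - {p})" using p by auto
          then have "\<Union>(D' ` (U - {l})) = D p \<union> P \<union> \<Union>(D ` (U - {l} - {p}))"
            using D'simps by (metis (no_types, lifting) DiffE SUP_cong UN_insert singletonI)
          also have "\<dots> = \<Union>(D ` (U - {l})) \<union> P" using p by auto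
          finally show ?thesis .
        qed
        also have "\<dots> = \<Union>(D ` U)" using lU p unfolding P_def by auto
        finally show "\<Union>(D' ` (U - {l})) = V" using F(3) by simp
      next
        fix e assume "e \<in> E"
        then obtain v w where e: "e = (v, w)" "(v, w) \<in> E" by (cases e) auto
        then obtain x where x: "x \<in> U" "v \<in> D x" "w \<in> D x" using F(4) by blast
        have "\<exists>x\<in>U - {l}. v \<in> D' x \<and> w \<in> D' x"
        proof (cases "x = l")
          case True
          then have "v \<in> D' p \<and> w \<in> D' p" using x D'simps unfolding P_def by auto
          then show ?thesis using p by blast
        next
          case False
          then have "v \<in> D' x \<and> w \<in> D' x" using x D'simps by (cases "x = p") auto
          then show ?thesis using x False by blast
        qed
        then show "case e of (v, w) \<Rightarrow> \<exists>x\<in>U - {l}. v \<in> D' x \<and> w \<in> D' x" using e by simp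
      next
        fix v assume v: "v \<in> V"
        show "linked R {x \<in> U - {l}. v \<in> D' x}"
        proof (cases "v \<in> P")
          case True
          have "x = p" if "x \<in> U - {l}" "v \<in> D' x" for x
          proof (rule ccontr)
            assume "x \<noteq> p"
            then have "v \<in> D x" using that(2) D'simps(2) by simp
            then show False using Pl[of x v] True that(1) by simp
          qed
          moreover have "p \<in> U - {l}" "v \<in> D' p" using p(1,2) True D'simps(1) by simp_all
          ultimately have "{x \<in> U - {l}. v \<in> D' x} = {p}" by blast
          then show ?thesis unfolding linked_def by simp
        next
          case False
          have "v \<in> D' x \<longleftrightarrow> v \<in> D x" for x
            using False D'simps(1) D'simps(2)[of x] by (cases "x = p") simp_all
          then have eq: "{x \<in> U - {l}. v \<in> D' x} = {x\<in>U. v \<in> D x} - {l}" by blast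
          have L: "linked R {x\<in>U. v \<in> D x}" using v by (rule F(5))
          show ?thesis
          proof (cases "v \<in> D l")
            case True
            then have "leaf_in R {x\<in>U. v \<in> D x} l" using leaf unfolding leaf_in_def by blast
            then show ?thesis unfolding eq by (rule linked_remove_leaf[OF assms(3,4) _ L])
          next
            case False
            then have "{x\<in>U. v \<in> D x} - {l} = {x\<in>U. v \<in> D x}" by blast
            then show ?thesis unfolding eq using L by simp
          qed
        qed
      qed
      have "S \<inter> (D' p - B p) = S \<inter> (D p - B p) \<union> S \<inter> P"
        using F(1)[OF p(1)] D'simps(1) unfolding P_def by blast
      then have c': "card (S \<inter> (D' p - B p)) \<le> card (S \<inter> (D p - B p)) + card (S \<inter> P)"
        by (simp add: card_Un_le)
      then have c2: "3 * card (S \<inter> (D' p - B p)) \<le> 2 * card S"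
        using 3 less.prems(6)[OF p(1)] by linarith
      show ?thesis
      proof (cases "3 * card (S \<inter> (D' p - B p)) \<le> card S")
        case True
        have small: "3 * card (S \<inter> (D' x - B x)) \<le> card S" if "x \<in> U - {l}" for x
          using that True less.prems(6)[of x] D'simps(2)[of x] by (cases "x = p") auto
        show ?thesis
        proof (rule less.hyps[of "U - {l}" D'])
          show "card (U - {l}) < card U" using less.prems(1) lU by (rule card_Diff1_less)
          show "U - {l} \<noteq> {}" using p by auto
          show "\<exists>l. leaf_in R W l" if "W \<subseteq> U - {l}" "W \<noteq> {}" for W
            using that less.prems(3)[of W] by auto
        qed (use less.prems F' small in auto)
      next
        case False
        \<comment> \<open>The enlarged private part holds more than a third and at most two thirds
          of \<open>S\<close>, so cutting at \<open>B p\<close> is balanced on both sides.\<close>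
        have "card (S - D' p) \<le> card (S - (D' p - B p))"
          using finS by (intro card_mono) auto
        then have "3 * card (S - D' p) \<le> 2 * card S"
          using False compl[of "D' p - B p"] by linarith
        then show ?thesis using cut[OF F' _ p(1) c2] p by simp
      qed
    qed
  qed
qed

section \<open>Leaves of undirected trees\<close>

lemma vertex_list_walk:
  assumes "ys \<noteq> []" "successively (\<lambda>x y. (x, y) \<in> R) ys"
  shows "pcas (hd ys) (zip ys (tl ys)) (last ys)"
    "pawalk_verts (hd ys) (zip ys (tl ys)) = ys" "set (zip ys (tl ys)) \<subseteq> R"
proof -
  have "pcas (hd ys) (zip ys (tl ys)) (last ys) \<and>
    pawalk_verts (hd ys) (zip ys (tl ys)) = ys \<and> set (zip ys (tl ys)) \<subseteq> R"
    using assms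
  proof (induction ys)
    case (Cons y ys)
    then show ?case by (cases ys) auto
  qed simp
  then show "pcas (hd ys) (zip ys (tl ys)) (last ys)"
    "pawalk_verts (hd ys) (zip ys (tl ys)) = ys" "set (zip ys (tl ys)) \<subseteq> R" by auto
qed

lemma undirected_tree_leaf:
  assumes "undirected_tree T" "W \<subseteq> pverts T" "W \<noteq> {}"
  shows "\<exists>l. leaf_in (parcs T) W l"
proof -
  interpret pair_graph T using assms(1) unfolding undirected_tree_def by simp
  let ?R = "\<lambda>x y. (x, y) \<in> parcs T"
  have sym: "sym (parcs T)" using pair_sym_arcs unfolding symmetric_def by simp
  have finW: "finite W" using assms(2) pair_finite_verts by (rule finite_subset)
  \<comment> \<open>The first vertex of a longest path is a leaf.\<close>
  define good where "good xs \<longleftrightarrow> xs \<noteq> [] \<and> distinct xs \<and> set xs \<subseteq> W \<and> successively ?R xs" for xs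
  obtain w where "w \<in> W" using assms(3) by blast
  then have "good [w]" unfolding good_def by simp
  moreover have "\<forall>xs. good xs \<longrightarrow> length xs < card W + 1"
    unfolding good_def using finW by (metis card_mono distinct_card less_add_one order_le_less_trans)
  ultimately obtain xs where xs: "good xs" "\<And>ys. good ys \<Longrightarrow> length ys \<le> length xs"
    using ex_has_greatest_nat[of good "[w]" length "card W + 1"] by metis
  define l where "l = hd xs"
  have lW: "l \<in> W" using xs(1) unfolding good_def l_def by auto
  have nb: "q \<in> W \<Longrightarrow> (l, q) \<in> parcs T \<Longrightarrow> 1 < length xs \<and> q = xs ! 1" for q
  proof (rule ccontr)
    assume q: "q \<in> W" "(l, q) \<in> parcs T" and not: "\<not> (1 < length xs \<and> q = xs ! 1)"
    have "q \<in> set xs"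
    proof (rule ccontr)
      assume "q \<notin> set xs"
      moreover have "(q, l) \<in> parcs T" using q sym by (auto dest: symD)
      ultimately have "good (q # xs)"
        using xs(1) q unfolding good_def l_def by (cases xs) auto
      then show False using xs(2) by fastforce
    qed
    then obtain i where i: "i < length xs" "xs ! i = q" by (auto simp: in_set_conv_nth)
    have "q \<noteq> l" using q pair_no_loops by fastforce
    then have "i \<noteq> 0" using i xs(1) unfolding good_def l_def by (metis hd_conv_nth)
    moreover have "i \<noteq> 1" using i not by auto
    ultimately have i2: "2 \<le> i" by linarith
    \<comment> \<open>The prefix ending in \<open>q\<close> is closed by the edge between
      \<open>q\<close> and \<open>l\<close> to a cycle of \<open>i + 1\<close> arcs. Having
      \<open>i \<ge> 2\<close> makes its length at least 3, so that it is not one edge traversed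
      back and forth.\<close>
    define zs where "zs = take (i + 1) xs"
    have zs: "length zs = i + 1" "distinct zs" "successively ?R zs" "last zs = q" "hd zs = l" "set zs \<subseteq> W"
    proof -
      have split: "xs = zs @ drop (i + 1) xs" unfolding zs_def by simp
      show "length zs = i + 1" using i unfolding zs_def by simp
      then show "last zs = q" using i unfolding zs_def by (simp add: take_Suc_conv_app_nth)
      show "distinct zs" using xs(1) unfolding good_def zs_def by simp
      show "successively ?R zs"
        using xs(1) split unfolding good_def by (metis successively_append_iff)
      show "hd zs = l" unfolding zs_def l_def by simp
      show "set zs \<subseteq> W" using xs(1) set_take_subset unfolding good_def zs_def by fastforce
    qed
    define ys where "ys = zs @ [l]"
    have "successively ?R ys"
      using zs q(2) sym unfolding ys_def by (auto simp: successively_append_iff dest: symD)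
    moreover have ends: "hd ys = l" "last ys = l" "ys \<noteq> []"
      using zs(1,5) unfolding ys_def by (cases zs; simp)+
    ultimately have walk: "pcas l (zip ys (tl ys)) l" "pawalk_verts l (zip ys (tl ys)) = ys"
      "set (zip ys (tl ys)) \<subseteq> parcs T"
      using vertex_list_walk[of ys "parcs T"] by (simp_all add: ends)
    have "tl ys = tl zs @ [l]" unfolding ys_def using zs(1) by (cases zs) auto
    moreover have "l \<notin> set (tl zs)" "distinct (tl zs)" using zs(1,2,5) by (cases zs; auto)+
    ultimately have dist: "distinct (tl ys)" by simp
    have len: "length (zip ys (tl ys)) = i + 1" unfolding ys_def using zs(1) by simp
    then have "zip ys (tl ys) \<noteq> []" by (metis add_is_0 list.size(3) zero_neq_one)
    then have "cycle (zip ys (tl ys))"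
      unfolding cycle_def awalk_def using walk dist lW assms(2)
      by (intro exI[of _ l]) auto
    then show False using assms(1) len i2 unfolding undirected_tree_def by fastforce
  qed
  then have "leaf_in (parcs T) W l" using lW unfolding leaf_in_def by metis
  then show ?thesis by blast
qed

text \<open>The family starts with \<open>D = B\<close>: there are no private vertices yet, so the
  bound of one third holds trivially.\<close>

lemma tree_decomposition_separable:
  assumes "pair_graph G" "tree_decomposition G T B" "\<And>x. x \<in> pverts T \<Longrightarrow> card (B x) \<le> m"
  shows "separable (parcs G) (pverts G) m"
  unfolding separable_def
proof (intro allI impI)
  fix S assume S: "S \<subseteq> pverts G"
  interpret G: pair_graph G by fact
  note D = assms(2)[unfolded tree_decomposition_def]
  have tree: "undirected_tree T" using D by simp
  interpret T: pair_graph T using tree unfolding undirected_tree_def by simp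
  have symT: "sym (parcs T)" using T.pair_sym_arcs unfolding symmetric_def by simp
  have symG: "sym (parcs G)" using G.pair_sym_arcs unfolding symmetric_def by simp
  have irr: "irrefl (parcs T)" using T.pair_no_loops unfolding irrefl_def by fastforce
  have ne: "pverts T \<noteq> {}"
    using tree connected_graph_iff[of T] unfolding undirected_tree_def by auto
  have conn: "{x \<in> pverts T. v \<in> B x} \<noteq> {} \<and> linked (parcs T) {x \<in> pverts T. v \<in> B x}"
    if "v \<in> pverts G" for v
    using D that connected_induced_iff[OF symT, of "{x \<in> pverts T. v \<in> B x}"] by auto
  have sub: "\<forall>x\<in>pverts T. B x \<subseteq> pverts G" using D by simp
  have "pverts G \<subseteq> \<Union>(B ` pverts T)"
  proof
    fix v assume "v \<in> pverts G"
    then show "v \<in> \<Union>(B ` pverts T)" using conn[of v] by auto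
  qed
  then have eq: "\<Union>(B ` pverts T) = pverts G" using sub by auto
  have edges: "\<forall>(v, w)\<in>parcs G. \<exists>x\<in>pverts T. v \<in> B x \<and> w \<in> B x" using D by auto
  have "bag_family (parcs T) (pverts T) B B (parcs G) (pverts G)"
    unfolding bag_family_def using eq edges conn by auto
  then show "\<exists>X Y. separation (parcs G) (pverts G) X Y \<and> card (X \<inter> Y) \<le> m \<and>
     3 * card (S - X) \<le> 2 * card S \<and> 3 * card (S - Y) \<le> 2 * card S"
    by (intro bag_family_separation[of "pverts T" "parcs T" B B "parcs G" "pverts G" m S])
      (use T.pair_finite_verts ne symT irr undirected_tree_leaf[OF tree] assms(3)
        G.pair_finite_verts symG S in auto)
qed

section \<open>From rooted trees of bags to tree-decompositions\<close>

text \<open>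
  Nodes are numbered from the root \<open>0\<close> so that \<open>f i < i\<close> is the parent of \<open>i\<close>. Connectedness
  of the nodes containing \<open>v\<close> means that all but one of them, the topmost, pass \<open>v\<close> to the parent.
\<close>

definition numbering :: "'a bagtree \<Rightarrow> (nat \<Rightarrow> nat) \<Rightarrow> (nat \<Rightarrow> 'a set) \<Rightarrow> bool" where
  "numbering t f b \<longleftrightarrow> b 0 = root_bag t \<and> b ` {..<order t} = bags t \<and>
     (\<forall>i. 0 < i \<longrightarrow> i < order t \<longrightarrow> f i < i) \<and>
     (\<forall>v. card {i. i < order t \<and> v \<in> b i} = spread t v) \<and>
     (\<forall>v\<in>\<Union>(bags t). \<exists>r<order t. v \<in> b r \<and>
        (\<forall>i<order t. v \<in> b i \<longrightarrow> i \<noteq> r \<longrightarrow> 0 < i \<and> v \<in> b (f i)))"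

lemma numberingD:
  assumes "numbering t f b"
  shows "b 0 = root_bag t" "b ` {..<order t} = bags t"
    "\<And>i. 0 < i \<Longrightarrow> i < order t \<Longrightarrow> f i < i"
    "\<And>v. card {i. i < order t \<and> v \<in> b i} = spread t v"
    "\<And>v. v \<in> \<Union>(bags t) \<Longrightarrow> \<exists>r<order t. v \<in> b r \<and>
        (\<forall>i<order t. v \<in> b i \<longrightarrow> i \<noteq> r \<longrightarrow> 0 < i \<and> v \<in> b (f i))"
proof -
  note N = assms[unfolded numbering_def]
  show "\<exists>r<order t. v \<in> b r \<and>
      (\<forall>i<order t. v \<in> b i \<longrightarrow> i \<noteq> r \<longrightarrow> 0 < i \<and> v \<in> b (f i))" if "v \<in> \<Union>(bags t)" for v
    using N that by (elim conjE) (rule bspec)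
qed (use assms in \<open>simp_all add: numbering_def\<close>)

lemma numbering_exists: "coherent t \<Longrightarrow> \<exists>f b. numbering t f b"
proof (induction t)
  case (Bag X)
  have "{i. i < Suc 0 \<and> P i} = (if P 0 then {0} else {})" for P by auto
  then have "numbering (Bag X) (\<lambda>i. 0) (\<lambda>i. X)"
    unfolding numbering_def by auto
  then show ?case by blast
next
  case (Attach t u)
  obtain f b where t: "numbering t f b" using Attach by auto
  obtain g c where u: "numbering u g c" using Attach by auto
  define n where "n = order t"
  define k where "k = order u"
  have n: "0 < n" and k: "0 < k" unfolding n_def k_def by (rule order_pos)+
  \<comment> \<open>The nodes of \<open>u\<close> are shifted by \<open>n\<close>; its root, now
    number \<open>n\<close>, becomes a child of the root 0.\<close>
  define h where "h i = (if i < n then f i else if i = n then 0 else n + g (i - n))" for i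
  define d where "d i = (if i < n then b i else c (i - n))" for i
  note b = numberingD[OF t, folded n_def]
  note c = numberingD[OF u, folded k_def]
  have int: "\<Union>(bags t) \<inter> \<Union>(bags u) \<subseteq> root_bag t \<inter> root_bag u"
    using Attach.prems by simp
  have split: "{i. i < n + k \<and> P i} = {i. i < n \<and> P i} \<union> (\<lambda>j. n + j) ` {j. j < k \<and> P (n + j)}"
    (is "?L = ?R") for P
  proof
    show "?L \<subseteq> ?R"
    proof
      fix i assume i: "i \<in> ?L"
      show "i \<in> ?R"
      proof (cases "i < n")
        case False
        then have "i = n + (i - n)" "i - n \<in> {j. j < k \<and> P (n + j)}" using i by auto
        then show ?thesis by blast
      qed (use i in auto)
    qed
  qed auto
  have low: "d i = b i" "h i = f i" if "i < n" for i using that unfolding d_def h_def by auto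
  have high: "d (n + j) = c j" "h (n + j) = (if j = 0 then 0 else n + g j)" for j
    unfolding d_def h_def by auto
  have "numbering (Attach t u) h d"
    unfolding numbering_def order.simps n_def[symmetric] k_def[symmetric]
  proof (intro conjI allI ballI impI)
    show "d 0 = root_bag (Attach t u)" using n low b(1) by simp
    have "{..<n + k} = {..<n} \<union> (\<lambda>j. n + j) ` {..<k}"
      using split[of "\<lambda>_. True"] by (simp add: lessThan_def)
    then have "d ` {..<n + k} = b ` {..<n} \<union> c ` {..<k}"
      using low(1) high(1) by (simp add: image_Un image_image)
    then show "d ` {..<n + k} = bags (Attach t u)" using b(2) c(2) by simp
    show "h i < i" if "0 < i" "i < n + k" for i
    proof (cases "i < n")
      case True
      then show ?thesis using that b(3)[of i] low(2) by simp
    next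
      case False
      then obtain j where j: "i = n + j" by (metis le_add_diff_inverse not_less)
      then show ?thesis using that n c(3)[of j] high(2)[of j] by (cases "j = 0") simp_all
    qed
    show "card {i. i < n + k \<and> v \<in> d i} = spread (Attach t u) v" for v
    proof -
      have "card {i. i < n + k \<and> v \<in> d i}
          = card {i. i < n \<and> v \<in> d i} + card ((\<lambda>j. n + j) ` {j. j < k \<and> v \<in> d (n + j)})"
        unfolding split[of "\<lambda>i. v \<in> d i"] by (rule card_Un_disjoint) auto
      also have "card ((\<lambda>j. n + j) ` {j. j < k \<and> v \<in> d (n + j)}) = card {j. j < k \<and> v \<in> c j}"
        unfolding high(1) by (rule card_image) simp
      also have "{i. i < n \<and> v \<in> d i} = {i. i < n \<and> v \<in> b i}" using low(1) by auto
      finally show ?thesis using b(4) c(4) by simp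
    qed
    fix v assume "v \<in> \<Union>(bags (Attach t u))"
    then consider "v \<in> \<Union>(bags t)" | "v \<notin> \<Union>(bags t)" "v \<in> \<Union>(bags u)" by auto
    then show "\<exists>r<n + k. v \<in> d r \<and>
        (\<forall>i<n + k. v \<in> d i \<longrightarrow> i \<noteq> r \<longrightarrow> 0 < i \<and> v \<in> d (h i))"
    proof cases
      case 1
      then obtain r where r: "r < n" "v \<in> b r"
        "\<And>i. i < n \<Longrightarrow> v \<in> b i \<Longrightarrow> i \<noteq> r \<Longrightarrow> 0 < i \<and> v \<in> b (f i)" using b(5) by blast
      have "0 < i \<and> v \<in> d (h i)" if i: "i < n + k" "v \<in> d i" "i \<noteq> r" for i
      proof (cases "i < n")
        case True
        then have "0 < i \<and> v \<in> b (f i)" using r(3) i low by simp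
        moreover have "f i < n" using b(3)[of i] calculation True by simp
        ultimately show ?thesis using low True by simp
      next
        case False
        then obtain j where j: "i = n + j" by (metis le_add_diff_inverse not_less)
        then have jk: "j < k" "v \<in> c j" using i high(1) by auto
        then have "v \<in> \<Union>(bags u)" using c(2) by auto
        then have rt: "v \<in> root_bag t" "v \<in> root_bag u" using int 1 by auto
        obtain s where s: "s < k" "v \<in> c s"
          "\<And>i. i < k \<Longrightarrow> v \<in> c i \<Longrightarrow> i \<noteq> s \<Longrightarrow> 0 < i \<and> v \<in> c (g i)"
          using c(5)[OF \<open>v \<in> \<Union>(bags u)\<close>] by blast
        \<comment> \<open>The vertex lies in the root bag of \<open>u\<close>, so its topmost node
          in \<open>u\<close> is that root. Across the new edge it is passed on to the root of
          \<open>t\<close>, which also holds it.\<close>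
        have "s = 0" using s(3)[of 0] k c(1) rt by auto
        show ?thesis
        proof (cases "j = 0")
          case True
          then show ?thesis using j n low(1)[of 0] high(2)[of 0] b(1) rt by simp
        next
          case False
          then have "v \<in> c (g j)" using s(3)[OF jk] \<open>s = 0\<close> by simp
          then show ?thesis using j False n high by simp
        qed
      qed
      then show ?thesis using r(1,2) low(1)[OF r(1)] by (intro exI[of _ r]) auto
    next
      case 2
      then obtain s where s: "s < k" "v \<in> c s"
        "\<And>i. i < k \<Longrightarrow> v \<in> c i \<Longrightarrow> i \<noteq> s \<Longrightarrow> 0 < i \<and> v \<in> c (g i)" using c(5) by blast
      have "0 < i \<and> v \<in> d (h i)" if i: "i < n + k" "v \<in> d i" "i \<noteq> n + s" for i
      proof (cases "i < n")
        case True
        then have "v \<in> b i" using i low by simp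
        then have "v \<in> \<Union>(bags t)" using b(2) True by auto
        then show ?thesis using 2 by simp
      next
        case False
        then obtain j where j: "i = n + j" by (metis le_add_diff_inverse not_less)
        then have "0 < j \<and> v \<in> c (g j)" using s(3)[of j] i high(1) by auto
        then show ?thesis using j high by simp
      qed
      then show ?thesis using s(1,2) high(1) by (intro exI[of _ "n + s"]) auto
    qed
  qed
  then show ?case by blast
qed

section \<open>Trees given by parent functions\<close>

definition parent_tree :: "nat \<Rightarrow> (nat \<Rightarrow> nat) \<Rightarrow> nat pair_pre_digraph" where
  "parent_tree n f = \<lparr>pverts = {..<n},
     parcs = {(i, j). i < n \<and> j < n \<and> (0 < i \<and> j = f i \<or> 0 < j \<and> i = f j)}\<rparr>"

lemma pcas_nth:
  assumes "pcas u p v" "p \<noteq> []"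
  shows "fst (p ! 0) = u" "snd (last p) = v" "\<And>i. i + 1 < length p \<Longrightarrow> snd (p ! i) = fst (p ! (i + 1))"
proof -
  have "fst (p ! 0) = u \<and> snd (last p) = v \<and> (\<forall>i. i + 1 < length p \<longrightarrow> snd (p ! i) = fst (p ! (i + 1)))"
    using assms
  proof (induction p arbitrary: u)
    case (Cons e p)
    show ?case
    proof (cases "p = []")
      case False
      then have IH: "fst (p ! 0) = snd e" "snd (last p) = v"
        "\<forall>i. i + 1 < length p \<longrightarrow> snd (p ! i) = fst (p ! (i + 1))"
        using Cons by auto
      then show ?thesis using Cons.prems False by (auto simp: nth_Cons split: nat.splits)
    qed (use Cons in auto)
  qed simp
  then show "fst (p ! 0) = u" "snd (last p) = v"
    "\<And>i. i + 1 < length p \<Longrightarrow> snd (p ! i) = fst (p ! (i + 1))" by auto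
qed

lemma pawalk_verts_eq: "pcas u p v \<Longrightarrow> pawalk_verts u p = u # map snd p"
  by (induction p arbitrary: u) auto

lemma parent_tree_acyclic:
  assumes f: "\<And>i. 0 < i \<Longrightarrow> i < n \<Longrightarrow> f i < i"
    and cyc: "pre_digraph.cycle (with_proj (parent_tree n f)) p" and len: "3 \<le> length p"
  shows False
proof -
  define L where "L = length p"
  obtain u where u: "pcas u p u" "distinct (tl (pawalk_verts u p))" "p \<noteq> []"
    "set p \<subseteq> parcs (parent_tree n f)"
    using cyc unfolding pre_digraph.cycle_def pre_digraph.awalk_def
    by (auto simp: cas_with_proj_eq awalk_verts_with_proj_eq)
  have dist: "distinct (map snd p)" using u(2) pawalk_verts_eq[OF u(1)] by simp
  have step: "snd (p ! i) = fst (p ! ((i + 1) mod L))" if "i < L" for i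
  proof (cases "i + 1 < L")
    case True
    then show ?thesis using pcas_nth(3)[OF u(1,3)] unfolding L_def by simp
  next
    case False
    then have "i + 1 = L" using that by simp
    then show ?thesis using pcas_nth(1,2)[OF u(1,3)] u(3) unfolding L_def
      by (metis add_diff_cancel_right' last_conv_nth mod_self)
  qed
  have "Max (snd ` set p) \<in> snd ` set p" using u(3) by (intro Max_in) auto
  then obtain e where "e \<in> set p" "Max (snd ` set p) = snd e" by blast
  moreover have "snd e' \<le> Max (snd ` set p)" if "e' \<in> set p" for e'
    using that by (intro Max_ge) auto
  ultimately have e: "e \<in> set p" "\<And>e'. e' \<in> set p \<Longrightarrow> snd e' \<le> snd e" by auto
  \<comment> \<open>Both neighbours of the largest node on a cycle are its parent.\<close>
  obtain i where i: "i < L" "p ! i = e" using e(1) unfolding L_def by (auto simp: in_set_conv_nth)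
  have L: "3 \<le> L" using len unfolding L_def .
  \<comment> \<open>The arcs \<open>p ! a\<close> and \<open>p ! c\<close> are the cyclic
    predecessor and successor of \<open>e\<close>; adding \<open>L\<close> before subtracting 1
    keeps the subtraction exact for \<open>i = 0\<close>.\<close>
  define a where "a = (i + L - 1) mod L"
  define c where "c = (i + 1) mod L"
  have ac: "a < L" "c < L" using L unfolding a_def c_def by auto
  have "(a + 1) mod L = i"
  proof -
    have "(a + 1) mod L = (i + L - 1 + 1) mod L" unfolding a_def by (rule mod_add_left_eq)
    then show ?thesis using i(1) L by simp
  qed
  then have fe: "snd (p ! a) = fst e" using step[OF ac(1)] i by simp
  have fc: "fst (p ! c) = snd e" using step[OF i(1)] i unfolding c_def by simp
  have mem: "p ! a \<in> set p" "p ! c \<in> set p" using ac unfolding L_def by auto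
  have le: "fst e \<le> snd e" "snd (p ! c) \<le> snd e" using e(2)[OF mem(1)] e(2)[OF mem(2)] fe by auto
  have par: "y = f x" if "(x, y) \<in> parcs (parent_tree n f) \<or> (y, x) \<in> parcs (parent_tree n f)"
    "y \<le> x" for x y
  proof -
    have "x < n" "y < n" "0 < x \<and> y = f x \<or> 0 < y \<and> x = f y"
      using that(1) unfolding parent_tree_def by auto
    then show ?thesis using f[of y] that(2) by linarith
  qed
  have "(fst e, snd e) \<in> parcs (parent_tree n f)" "(snd e, snd (p ! c)) \<in> parcs (parent_tree n f)"
    using u(4) e(1) mem(2) fc by auto (metis prod.collapse subsetD)
  then have "fst e = f (snd e)" "snd (p ! c) = f (snd e)" using par le by blast+
  \<comment> \<open>Both arcs end in the parent of the largest node. Since heads on a cycle are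
    distinct, predecessor and successor coincide, which forces \<open>L \<le> 2\<close>.\<close>
  then have "map snd p ! a = map snd p ! c" using fe ac unfolding L_def by simp
  then have "a = c" using dist ac nth_eq_iff_index_eq[OF dist] unfolding L_def by simp
  then show False
    using i(1) L unfolding a_def c_def by (auto simp: mod_if split: if_splits)
qed

text \<open>Parents have smaller numbers, so following them from any node of \<open>W\<close> stays
  in \<open>W\<close> and terminates in \<open>r\<close>.\<close>

lemma parent_tree_linked:
  assumes f: "\<And>i. 0 < i \<Longrightarrow> i < n \<Longrightarrow> f i < i"
    and W: "W \<subseteq> {..<n}" "r \<in> W" "\<And>i. i \<in> W \<Longrightarrow> i \<noteq> r \<Longrightarrow> 0 < i \<and> f i \<in> W"
  shows "linked (parcs (parent_tree n f)) W"
proof -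
  let ?R = "Restr (parcs (parent_tree n f)) W"
  have sym: "sym ?R" unfolding parent_tree_def sym_def by auto
  have to_r: "(i, r) \<in> ?R\<^sup>*" if "i \<in> W" for i
    using that
  proof (induction i rule: less_induct)
    case (less i)
    show ?case
    proof (cases "i = r")
      case False
      then have "0 < i" "f i \<in> W" using W(3) less.prems by auto
      then have "f i < i" "i < n" "(i, f i) \<in> ?R"
        using f[of i] W(1) less.prems unfolding parent_tree_def by auto
      then show ?thesis using less.IH \<open>f i \<in> W\<close> by (meson converse_rtrancl_into_rtrancl)
    qed simp
  qed
  have "(r, j) \<in> ?R\<^sup>*" if "j \<in> W" for j
    using to_r[OF that] sym_rtrancl[OF sym] by (auto dest: symD)
  then show ?thesis unfolding linked_def using to_r by (meson rtrancl_trans)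
qed

lemma undirected_tree_parent_tree:
  assumes f: "\<And>i. 0 < i \<Longrightarrow> i < n \<Longrightarrow> f i < i" and n: "0 < n"
  shows "undirected_tree (parent_tree n f)"
proof -
  have "finite (parcs (parent_tree n f))"
    by (rule finite_subset[of _ "{..<n} \<times> {..<n}"]) (auto simp: parent_tree_def)
  then have graph: "pair_graph (parent_tree n f)"
  proof unfold_locales
    show "fst e \<noteq> snd e" if "e \<in> parcs (parent_tree n f)" for e
      using that f[of "fst e"] f[of "snd e"] unfolding parent_tree_def by auto
  qed (auto simp: parent_tree_def symmetric_def sym_def)
  moreover have "linked (parcs (parent_tree n f)) {..<n}"
  proof (rule parent_tree_linked[of n f _ 0])
    show "0 < i \<and> f i \<in> {..<n}" if "i \<in> {..<n}" "i \<noteq> 0" for i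
      using that f[of i] by auto
  qed (use f n in auto)
  then have "connected (with_proj (parent_tree n f))"
    using connected_graph_iff[OF graph] n by (auto simp: parent_tree_def)
  ultimately show ?thesis
    unfolding undirected_tree_def using parent_tree_acyclic[of n f] f by blast
qed

lemma bagtree_tree_decomposition:
  assumes "decomposes (parcs G) (pverts G) t"
  obtains T :: "nat pair_pre_digraph" and B where "tree_decomposition G T B"
    "B ` pverts T = bags t" "td_order T = order t" "\<And>v. td_spread T B v = spread t v"
proof -
  have t: "coherent t" "\<Union>(bags t) = pverts G"
    "\<forall>(v, w)\<in>parcs G. \<exists>X\<in>bags t. v \<in> X \<and> w \<in> X"
    using assms unfolding decomposes_def by simp_all
  obtain f b where "numbering t f b" using numbering_exists[OF t(1)] by blast
  note b = numberingD(2-5)[OF this]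
  define T where "T = parent_tree (order t) f"
  have verts: "pverts T = {..<order t}" unfolding T_def parent_tree_def by simp
  have tree: "undirected_tree T"
    unfolding T_def using b(2) order_pos by (rule undirected_tree_parent_tree)
  have symT: "sym (parcs T)" unfolding T_def parent_tree_def sym_def by auto
  have conn: "connected (with_proj T \<restriction> {x \<in> pverts T. v \<in> b x})" if v: "v \<in> pverts G" for v
  proof -
    obtain r where r: "r < order t" "v \<in> b r"
      "\<And>i. i < order t \<Longrightarrow> v \<in> b i \<Longrightarrow> i \<noteq> r \<Longrightarrow> 0 < i \<and> v \<in> b (f i)"
      using b(4)[of v] v t(2) by blast
    have "linked (parcs T) {x \<in> pverts T. v \<in> b x}"
      unfolding T_def
    proof (rule parent_tree_linked[of "order t" f _ r])
      show "0 < i \<and> f i \<in> {x \<in> pverts (parent_tree (order t) f). v \<in> b x}"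
        if "i \<in> {x \<in> pverts (parent_tree (order t) f). v \<in> b x}" "i \<noteq> r" for i
        using that r(3)[of i] b(2)[of i] verts unfolding T_def by auto
    qed (use r b(2) verts in \<open>auto simp: T_def\<close>)
    moreover have "r \<in> {x \<in> pverts T. v \<in> b x}" using r(1,2) verts by simp
    moreover have "{x \<in> pverts T. v \<in> b x} \<subseteq> pverts T" by blast
    ultimately show ?thesis by (subst connected_induced_iff[OF symT]) blast+
  qed
  have "b x \<subseteq> pverts G" if "x \<in> pverts T" for x
    using that b(1)[symmetric] t(2) verts by auto
  moreover have "\<exists>x\<in>pverts T. v \<in> b x \<and> w \<in> b x" if vw: "(v, w) \<in> parcs G" for v w
  proof -
    obtain X where X: "X \<in> bags t" "v \<in> X" "w \<in> X" using t(3) vw by blast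
    have "X \<in> b ` {..<order t}" using X(1) b(1) by simp
    then obtain i where "i < order t" "b i = X" by blast
    then show ?thesis using X(2,3) verts by auto
  qed
  ultimately have "tree_decomposition G T b"
    unfolding tree_decomposition_def using tree conn by blast
  then show thesis
    using that[of T b] b(1,3) verts unfolding td_order_def td_spread_def by simp
qed

section \<open>Choice of the constants and combination of the bounds\<close>

theorem theorem4:
  fixes G :: "'a pair_pre_digraph" and k :: int
  assumes "pair_graph G" and "treewidth G \<le> k"
  shows "\<exists>(T :: nat pair_pre_digraph) B.
    tree_decomposition G T B \<and>
    td_width T B \<le> 56 * k + 58 \<and>
    real (td_order T) \<le> max (real (card (pverts G)) / real_of_int (14 * k + 14)) 1 \<and>
    (\<forall>v\<in>pverts G. td_spread T B v \<le> degree G v + 1)"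
proof -
  interpret G: pair_graph G by fact
  let ?V = "pverts G" and ?E = "parcs G"
  obtain T0 :: "nat pair_pre_digraph" and B0
    where T0: "tree_decomposition G T0 B0" "td_width T0 B0 = treewidth G"
    using treewidth_attained[OF assms(1)] by blast
  define m where "m = nat (k + 1)"
  have tree0: "undirected_tree T0" using T0(1) unfolding tree_decomposition_def by simp
  then have T0fin: "finite (pverts T0)" "pverts T0 \<noteq> {}"
    using connected_graph_iff[of T0] pair_fin_digraph.pair_finite_verts[of T0]
    unfolding undirected_tree_def pair_graph_def pair_digraph_def by auto
  have "Max ((\<lambda>x. card (B0 x)) ` pverts T0) \<le> m"
    using T0(2) assms(2) unfolding td_width_def m_def by linarith
  then have B0: "card (B0 x) \<le> m" if "x \<in> pverts T0" for x
    using that T0fin by (meson Max_ge finite_imageI imageI le_trans)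
  \<comment> \<open>Every width is at least -1, hence \<open>k + 1\<close> is non-negative and
    \<open>nat\<close> truncates nothing.\<close>
  have mk: "int m = k + 1"
    using T0(2) assms(2) unfolding td_width_def m_def by linarith
  have deg: "degree G v = card (nbrs ?E v)" for v
    unfolding degree_eq_card_neighbours nbrs_def ..
  have symE: "sym ?E" using G.pair_sym_arcs unfolding symmetric_def by simp
  have EV: "?E \<subseteq> ?V \<times> ?V" using G.in_arcsD1 G.in_arcsD2 by auto
  \<comment> \<open>The two alternatives for the order match the two arguments of the maximum. A
    single bag serves graphs with at most \<open>14 * m\<close> vertices, including the null graph
    when \<open>m = 0\<close>.\<close>
  have "\<exists>t. decomposes ?E ?V t \<and> (\<forall>X\<in>bags t. card X \<le> 56 * m) \<and>
      (order t = 1 \<or> 0 < m \<and> 14 * m * order t \<le> card ?V) \<and> (\<forall>v. spread t v \<le> card (nbrs ?E v) + 1)"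
  proof (cases "card ?V \<le> 14 * m")
    case True
    have "decomposes ?E ?V (Bag ?V)" unfolding decomposes_def using EV by auto
    then show ?thesis using True by (intro exI[of _ "Bag ?V"]) auto
  next
    case False
    \<comment> \<open>With \<open>m = 0\<close> all bags would be empty and so would the graph,
      which belongs to the previous case.\<close>
    have m: "0 < m"
    proof (rule ccontr)
      assume "\<not> 0 < m"
      have "v \<notin> ?V" for v
      proof
        assume "v \<in> ?V"
        then have "connected (with_proj T0 \<restriction> {x \<in> pverts T0. v \<in> B0 x})"
          using T0(1) unfolding tree_decomposition_def by blast
        then obtain x where x: "x \<in> pverts T0" "v \<in> B0 x"
          unfolding connected_def strongly_connected_def mk_symmetric_def by auto
        have "finite (B0 x)"
          using T0(1) x(1) G.pair_finite_verts unfolding tree_decomposition_def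
          by (meson finite_subset)
        then show False using B0[OF x(1)] x(2) \<open>\<not> 0 < m\<close> by auto
      qed
      then have "?V = {}" by blast
      then show False using False by simp
    qed
    have sep: "separable ?E ?V m"
      using tree_decomposition_separable[OF assms(1) T0(1) B0] by simp
    \<comment> \<open>The size \<open>14 * m\<close> is within the limit \<open>24 * m\<close> of
      the recursion and makes the root bag large enough for \<open>compress\<close> with
      \<open>q = 14 * m\<close>.\<close>
    obtain S where S: "S \<subseteq> ?V" "card S = 14 * m"
      using False obtain_subset_with_card_n[of "14 * m" ?V] by auto
    obtain t where "low_spread m ?E ?V S t"
      using low_spread_exists[OF sep G.pair_finite_verts m _ _ symE EV S(1)] S(2) by auto
    then have t: "coherent t" "\<Union>(bags t) = ?V" "\<forall>(v, w)\<in>?E. \<exists>X\<in>bags t. v \<in> X \<and> w \<in> X"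
      "S \<subseteq> root_bag t" "\<forall>X\<in>bags t. card X \<le> 27 * m" "\<And>v. spread t v \<le> card (nbrs ?E v) + 1"
      unfolding low_spread_def decomposes_def by simp_all
    have "finite (root_bag t)"
      using root_subset_bags[of t] t(2) G.pair_finite_verts by (auto intro: finite_subset)
    then have "14 * m \<le> card (root_bag t)" using S(2) t(4) by (metis card_mono)
    \<comment> \<open>The bags have size at most \<open>27 * m + 28 * m = 55 * m\<close>, within the
      bound \<open>56 * m\<close>.\<close>
    then obtain s where s: "coherent s" "\<Union>(bags s) = \<Union>(bags t)"
      "\<And>X. X \<in> bags s \<Longrightarrow> card X \<le> 27 * m + 2 * (14 * m)"
      "\<And>v. spread s v \<le> spread t v" "14 * m * order s \<le> card (\<Union>(bags t))"
      "\<And>X. X \<in> bags t \<Longrightarrow> \<exists>Y\<in>bags s. X \<subseteq> Y"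
      using compress[of t "27 * m" "14 * m"] t m G.pair_finite_verts by auto
    have "\<exists>X\<in>bags s. v \<in> X \<and> w \<in> X" if vw: "(v, w) \<in> ?E" for v w
    proof -
      obtain X where "X \<in> bags t" "v \<in> X" "w \<in> X" using t(3) vw by blast
      then show ?thesis using s(6)[of X] by blast
    qed
    then have "decomposes ?E ?V s" unfolding decomposes_def using s(1,2) t(2) by auto
    moreover have "card X \<le> 56 * m" if "X \<in> bags s" for X using s(3)[OF that] by simp
    moreover have "spread s v \<le> card (nbrs ?E v) + 1" for v
      using s(4) t(6) le_trans by blast
    ultimately show ?thesis using s(5) t(2) m by (intro exI[of _ s]) auto
  qed
  then obtain t where t: "decomposes ?E ?V t" "\<And>X. X \<in> bags t \<Longrightarrow> card X \<le> 56 * m"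
    "order t = 1 \<or> 0 < m \<and> 14 * m * order t \<le> card ?V"
    "\<And>v. spread t v \<le> card (nbrs ?E v) + 1" by blast
  obtain T :: "nat pair_pre_digraph" and B where T: "tree_decomposition G T B"
    "B ` pverts T = bags t" "td_order T = order t" "\<And>v. td_spread T B v = spread t v"
    using bagtree_tree_decomposition[OF t(1)] by blast
  have "finite (pverts T)" "pverts T \<noteq> {}"
    using T(3) order_pos[of t] card_gt_0_iff[of "pverts T"] unfolding td_order_def by auto
  then have "Max ((\<lambda>x. card (B x)) ` pverts T) \<le> 56 * m"
    using t(2) T(2) by (intro Max.boundedI) auto
  then have "td_width T B \<le> 56 * k + 58"
    unfolding td_width_def using mk by linarith
  moreover have "real (td_order T) \<le> max (real (card ?V) / real_of_int (14 * k + 14)) 1"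
    using t(3)
  proof
    assume m: "0 < m \<and> 14 * m * order t \<le> card ?V"
    have "14 * k + 14 = int (14 * m)" using mk by simp
    then have eq: "real_of_int (14 * k + 14) = 14 * real m"
      by (metis of_int_of_nat_eq of_nat_mult of_nat_numeral)
    have "real (14 * m * order t) \<le> real (card ?V)" using m by linarith
    then have "real (order t) \<le> real (card ?V) / (14 * real m)"
      using m by (simp add: field_simps)
    then show ?thesis using T(3) eq by simp
  qed (use T(3) in simp)
  ultimately show ?thesis using T(1,4) t(4) deg by (intro exI conjI) auto
qed

end
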